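(* Let $a(z)\not\equiv 0$, $b(z)$ and $c(z)$ be rational functions of $z$, and let $w(z)$ be a non-rational meromorphic solution (meromorphic in the whole complex plane) of $$w(z+1)-w(z-1)=\frac{a(z)w'(z)+b(z)w(z)}{w(z)^2}+c(z).$$ If the hyper-order $\rho_2(w)$ of $w$ is strictly less than one and for some $\epsilon>0$ $$\overline{N}\left(r,\frac1w\right)\ge\left(\frac34+\epsilon\right)T(r,w)+S(r,w),$$ then the equation has the form $$w(z+1)-w(z-1)=\frac{(\lambda+\mu z)w'(z)+(\nu\lambda+\mu(\nu z-1))w(z)}{w(z)^2},$$ where $\lambda$, $\mu$ and $\nu$ are constants; that is, there are constants $\lambda,\mu,\nu\in\mathbb{C}$ such that $a(z)=\lambda+\mu z$, $b(z)=\nu\lambda+\mu(\nu z-1)$ and $c(z)\equiv 0$.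
   Context: For a function $w$ meromorphic in $\mathbb{C}$, $T(r,w)$ denotes the Nevanlinna characteristic function, and the hyper-order of $w$ is $$\rho_2(w)=\limsup_{r\to\infty}\frac{\log\log T(r,w)}{\log r}.$$ $\overline{N}(r,f)$ denotes the integrated Nevanlinna counting function of the poles of $f$ ignoring multiplicities; thus $\overline{N}(r,1/w)$ counts the distinct zeros of $w$. $S(r,w)$ denotes any quantity that is $o(T(r,w))$ as $r\to\infty$ outside of an exceptional set of finite logarithmic measure; the displayed inequality is understood to hold with some such quantity $S(r,w)$. *)

theory Defs
  imports
    "HOL-Complex_Analysis.Complex_Analysis"
    "HOL-Library.Landau_Symbols"
begin

text \<open>
  A meromorphic function is represented by a total function \<open>f :: complex \<Rightarrow> complex\<close> with
  \<open>f meromorphic_on UNIV\<close>, whose values on a closed discrete set are irrelevant. Accordingly, every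
  identity between meromorphic functions is stated with \<open>\<forall>\<^sub>\<approx>z\<close>, i.e.\ outside a set without limit
  points, and poles and their orders are taken in the sense of \<open>is_pole\<close> and \<open>zorder\<close>, which only
  depend on punctured neighbourhoods.
\<close>

definition rational_function :: "(complex \<Rightarrow> complex) \<Rightarrow> bool" where
  "rational_function f \<longleftrightarrow>
     (\<exists>p q :: complex poly. q \<noteq> 0 \<and> (\<forall>\<^sub>\<approx>z. f z = poly p z / poly q z))"

definition log_plus :: "real \<Rightarrow> real" where
  "log_plus x = ln (max 1 x)"

definition proximity :: "(complex \<Rightarrow> complex) \<Rightarrow> real \<Rightarrow> real" where
  "proximity f r =
     1 / (2 * pi) * integral {0..2 * pi} (\<lambda>\<theta>. log_plus (norm (f (of_real r * cis \<theta>))))"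

definition pole_count :: "(complex \<Rightarrow> complex) \<Rightarrow> real \<Rightarrow> nat" where
  "pole_count f r = (\<Sum>z | norm z \<le> r \<and> is_pole f z. nat (- zorder f z))"

definition distinct_pole_count :: "(complex \<Rightarrow> complex) \<Rightarrow> real \<Rightarrow> nat" where
  "distinct_pole_count f r = card {z. norm z \<le> r \<and> is_pole f z}"

definition integrated_count :: "(real \<Rightarrow> nat) \<Rightarrow> real \<Rightarrow> real" where
  "integrated_count n r =
     integral {0..r} (\<lambda>t. (real (n t) - real (n 0)) / t) + real (n 0) * ln r"

definition nevanlinna_N :: "(complex \<Rightarrow> complex) \<Rightarrow> real \<Rightarrow> real" where
  "nevanlinna_N f = integrated_count (pole_count f)"

definition nevanlinna_Nbar :: "(complex \<Rightarrow> complex) \<Rightarrow> real \<Rightarrow> real" where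
  "nevanlinna_Nbar f = integrated_count (distinct_pole_count f)"

definition nevanlinna_T :: "(complex \<Rightarrow> complex) \<Rightarrow> real \<Rightarrow> real" where
  "nevanlinna_T f r = proximity f r + nevanlinna_N f r"

text \<open>Only meaningful for non-constant \<open>f\<close>, for which the iterated logarithm is eventually taken of
  arguments greater than 1.\<close>

definition hyper_order :: "(complex \<Rightarrow> complex) \<Rightarrow> ereal" where
  "hyper_order f = Limsup at_top (\<lambda>r. ereal (ln (ln (nevanlinna_T f r)) / ln r))"

definition finite_log_measure :: "real set \<Rightarrow> bool" where
  "finite_log_measure E \<longleftrightarrow>
     E \<in> sets lebesgue \<and> (\<integral>\<^sup>+r\<in>E \<inter> {1..}. ennreal (1 / r) \<partial>lebesgue) < \<infinity>"

text \<open>\<open>small_error f S\<close>: the function \<open>S\<close> is an admissible value of the symbol \<open>S(r, f)\<close>. The filter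
  describes \<open>r\<close> tending to infinity within the complement of the exceptional set.\<close>

definition small_error :: "(complex \<Rightarrow> complex) \<Rightarrow> (real \<Rightarrow> real) \<Rightarrow> bool" where
  "small_error f S \<longleftrightarrow>
     (\<exists>E. finite_log_measure E \<and> S \<in> o[inf at_top (principal (- E))](nevanlinna_T f))"

end

theory Submission
  imports Defs
begin

text \<open>
  The proof is a count of zeros against poles. Comparing Laurent expansions in the equation, a zero of
  \<open>w\<close> at a generic point \<open>z\<close> forces a pole of order at least two at \<open>z - 1\<close> or \<open>z + 1\<close>, and
  \<open>w (p + 1) - w (p - 1)\<close> is determined at a pole \<open>p\<close>. Letting every zero distribute a unit charge
  to the adjacent poles, a pole of order \<open>m\<close> receives at most \<open>3 m / 4\<close> unless \<open>c = 0\<close> and it is a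
  double pole between two zeros at \<open>p \<plusminus> 1\<close> with \<open>p \<plusminus> 2\<close> not poles. If there are only finitely many of
  these exceptions, then \<open>Nbar(r, 1/w)\<close> is at most \<open>(3/4 + o(1)) N(r + 1, w) + O(log r)\<close>, so the
  hypothesis makes \<open>N\<close> grow geometrically in unit steps outside a set of finite logarithmic measure,
  which hyper-order below one rules out. Otherwise the two leading Laurent coefficients at the exceptional
  poles give \<open>a(z + 1) + a(z - 1) = 2 a(z)\<close> and the \<open>2\<close>-periodicity of \<open>(a' + b) / a\<close>, first at
  infinitely many points and then identically, as the coefficients are rational. The exclusion of finitely many
  poles rests on the fact that \<open>w = R exp h\<close> with \<open>R\<close> rational and \<open>m(r, w) = O(log r)\<close> is rational.
\<close>

section \<open>Laurent series at zeros and poles\<close>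

text \<open>The constant 3/4 is the worst ratio that the charging allows. For \<open>c = 0\<close> a
  double pole between two zeros receives at most 1 + 1/2 = 3/4 * 2 as soon as one of these zeros has
  a pole on its other side as well. Without such sharing it receives 2 and the ratio jumps to 1, so
  this configuration has to be rigid. It is: the leading coefficients of the two zeros and the two
  leading ones of the pole satisfy five equations that involve only three independent combinations
  of these four unknowns, and elimination leaves two relations between \<open>a\<close> and
  \<open>b\<close>. The obstacle in the counting is that charge travels distance 1, so zeros in a
  disc of radius r are compared with poles in the disc of radius r + 1. No asymptotic equality of
  N(r + 1) and N(r) is established; the contradiction comes directly from ln N rising by a fixed
  amount in every unit step that starts off the exceptional set. For this N must outgrow log r,
  which requires infinitely many poles; the remaining case needs an argument of its own.\<close>

text \<open>Formal counterpart of \<open>(a w' + b w) / w^2\<close> at one point. The coefficients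
  are power series because only distant points, where the rational coefficients are analytic, are
  expanded; the solution itself may have a pole there.\<close>

definition delay_term :: "complex fps \<Rightarrow> complex fps \<Rightarrow> complex fls \<Rightarrow> complex fls" where
  "delay_term a b u = (fps_to_fls a * fls_deriv u + fps_to_fls b * u) / u^2"

text \<open>Let n be the order of \<open>u\<close>. The leading coefficient of \<open>a u'\<close>
  carries the factor n, so it survives for n different from 0, and \<open>b u\<close> starts too
  late to interfere at order n - 1. Division by \<open>u^2\<close> leaves - n - 1: a zero produces a
  pole of order at least 2, a pole of order m produces order m - 1.\<close>

lemma delay_term_subdegree:
  assumes "u \<noteq> 0" and "fls_subdegree u \<noteq> 0" and "fps_nth a 0 \<noteq> 0"
  shows "delay_term a b u \<noteq> 0"
    and "fls_subdegree (delay_term a b u) = - fls_subdegree u - 1"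
proof -
  let ?a = "fps_to_fls a" and ?b = "fps_to_fls b"
  have sa: "fls_subdegree ?a = 0"
    using assms(3) by (simp add: fls_subdegree_fls_to_fps)
  have a0: "?a \<noteq> 0"
    using assms(3) by auto
  have du: "fls_subdegree (fls_deriv u) = fls_subdegree u - 1"
    by (rule fls_subdegree_deriv) (use assms in auto)
  have du0: "fls_deriv u \<noteq> 0"
  proof -
    have "fls_nth (fls_deriv u) (fls_subdegree u - 1) = of_int (fls_subdegree u) * fls_nth u (fls_subdegree u)"
      by (subst fls_deriv_nth) simp
    hence "fls_nth (fls_deriv u) (fls_subdegree u - 1) \<noteq> 0"
      using assms by simp
    thus ?thesis by (metis fls_zero_nth)
  qed
  have main: "fls_subdegree (?a * fls_deriv u + ?b * u) = fls_subdegree u - 1 \<and>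
        ?a * fls_deriv u + ?b * u \<noteq> 0"
  proof (cases "b = 0")
    case True
    thus ?thesis using sa a0 du du0 by simp
  next
    case False
    have sb: "fls_subdegree ?b \<ge> 0"
      by (rule fls_subdegree_fls_to_fps_gt0)
    have lt: "fls_subdegree (?a * fls_deriv u) < fls_subdegree (?b * u)"
      using False assms(1) sa a0 du du0 sb by simp
    have "fls_subdegree (?a * fls_deriv u + ?b * u) = fls_subdegree (?a * fls_deriv u)"
      using lt a0 du0 by (intro fls_subdegree_add_eq1) auto
    moreover have "?a * fls_deriv u + ?b * u \<noteq> 0"
    proof
      assume "?a * fls_deriv u + ?b * u = 0"
      hence "?a * fls_deriv u = - (?b * u)"
        by (simp add: eq_neg_iff_add_eq_0)
      thus False using lt by (metis fls_uminus_subdegree less_irrefl)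
    qed
    ultimately show ?thesis using sa a0 du du0 by simp
  qed
  show "delay_term a b u \<noteq> 0"
    using main assms by (simp add: delay_term_def)
  show "fls_subdegree (delay_term a b u) = - fls_subdegree u - 1"
    using main assms by (simp add: delay_term_def fls_divide_subdegree fls_subdegree_pow)
qed

lemma delay_term_eq_iff:
  assumes "u \<noteq> 0"
  shows "delay_term a b u = d \<longleftrightarrow> d * u^2 = fps_to_fls a * fls_deriv u + fps_to_fls b * u"
  using assms by (auto simp: delay_term_def field_simps)

lemma delay_term_uminus: "delay_term (-a) (-b) u = - delay_term a b u"
  by (simp add: delay_term_def minus_divide_left)

lemma fls_subdegree_nonneg_obtain:
  fixes u :: "complex fls"
  assumes "fls_subdegree u \<ge> 0"
  obtains U where "u = fps_to_fls U"
  using assms fls_regpart_to_fls_trivial by metis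

lemma fls_factor_X_power:
  fixes u :: "complex fls"
  assumes "fls_subdegree u = n" and "u \<noteq> 0"
  obtains U where "u = fls_X powi n * fps_to_fls U" "fps_nth U 0 \<noteq> 0"
proof -
  have X: "fls_X powi n \<noteq> (0 :: complex fls)" by simp
  have sd: "fls_subdegree (u / fls_X powi n) = 0"
    using assms X by (simp add: fls_divide_subdegree)
  then obtain U where U: "u / fls_X powi n = fps_to_fls U"
    using fls_subdegree_nonneg_obtain[of "u / fls_X powi n"] by auto
  have "fls_nth (fps_to_fls U) (fls_subdegree (fps_to_fls U)) \<noteq> 0"
    using U assms X by (intro nth_fls_subdegree_nonzero) (metis divide_eq_0_iff)
  hence "fps_nth U 0 \<noteq> 0" using sd U by simp
  moreover have "u = fls_X powi n * fps_to_fls U"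
    using U X by (simp add: field_simps)
  ultimately show ?thesis using that by blast
qed

text \<open>Multiplying by \<open>u^2\<close> with \<open>u = X U\<close> clears all denominators.
  The regular series \<open>x\<close> then enters only from \<open>X^2\<close> on, so the two lowest
  coefficients relate \<open>P\<close> and \<open>U\<close> to \<open>a\<close> and \<open>b\<close>
  alone.\<close>

lemma zero_of_delay_term_coeffs:
  fixes a b P U x :: "complex fps"
  assumes "delay_term a b (fls_X * fps_to_fls U) = fps_to_fls P / fls_X^2 - fps_to_fls x"
    and U0: "fps_nth U 0 \<noteq> 0"
  shows "fps_nth P 0 * fps_nth U 0 = fps_nth a 0"
    and "fps_nth P 1 * fps_nth U 0 = fps_nth a 1 + fps_nth b 0"
proof -
  let ?u = "fls_X * fps_to_fls U"
  have nz: "?u \<noteq> 0" using U0 by auto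
  have "(fps_to_fls P / fls_X^2 - fps_to_fls x) * ?u^2
          = fps_to_fls a * fls_deriv ?u + fps_to_fls b * ?u"
    using assms(1) delay_term_eq_iff[OF nz] by simp
  also have "(fps_to_fls P / fls_X^2 - fps_to_fls x) * ?u^2 =
     fps_to_fls P * fps_to_fls U ^2 - fps_to_fls x * ?u^2"
  proof -
    have "(p / X^2 - y) * (X * v)^2 = p * v^2 - y * (X * v)^2" if "X \<noteq> 0" for p v y X :: "complex fls"
      using that by (simp add: field_simps power2_eq_square)
    from this[of fls_X] show ?thesis by simp
  qed
  also have "\<dots> = fps_to_fls (P * U^2 - x * (fps_X * U)^2)"
    by (simp add: fls_times_fps_to_fls fps_to_fls_power)
  also have "fps_to_fls a * fls_deriv ?u + fps_to_fls b * ?u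
     = fps_to_fls (a * fps_deriv (fps_X * U) + b * (fps_X * U))"
    by (simp add: fls_times_fps_to_fls flip: fls_deriv_fps_to_fls)
  finally have eq: "P * U^2 - x * (fps_X * U)^2 = a * fps_deriv (fps_X * U) + b * (fps_X * U)"
    by (simp only: fps_to_fls_eq_iff)
  have "fps_nth (P * U^2 - x * (fps_X * U)^2) 0 = fps_nth P 0 * fps_nth U 0 ^ 2"
    by (simp add: power2_eq_square)
  moreover have "fps_nth (a * fps_deriv (fps_X * U) + b * (fps_X * U)) 0 = fps_nth a 0 * fps_nth U 0"
    by simp
  ultimately have "fps_nth P 0 * fps_nth U 0 ^ 2 = fps_nth a 0 * fps_nth U 0"
    using arg_cong[OF eq, of "\<lambda>F. fps_nth F 0"] by simp
  thus 0: "fps_nth P 0 * fps_nth U 0 = fps_nth a 0"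
    using U0 by (simp add: power2_eq_square)
  have 1: "fps_nth (P * U^2 - x * (fps_X * U)^2) 1
      = fps_nth P 1 * fps_nth U 0 ^ 2 + 2 * fps_nth P 0 * fps_nth U 0 * fps_nth U 1"
    by (simp add: power2_eq_square fps_mult_nth_1 algebra_simps)
  have 2: "fps_nth (a * fps_deriv (fps_X * U) + b * (fps_X * U)) 1
      = 2 * fps_nth a 0 * fps_nth U 1 + fps_nth a 1 * fps_nth U 0 + fps_nth b 0 * fps_nth U 0"
    by (simp add: fps_mult_nth_1 algebra_simps numeral_2_eq_2)
  \<comment> \<open>The second coefficient of \<open>U\<close> cancels: its factors
    \<open>2 P_0 U_0\<close> and \<open>2 a_0\<close> agree by the relation at order 0.\<close>
  have "fps_nth P 1 * fps_nth U 0 ^ 2 = (fps_nth a 1 + fps_nth b 0) * fps_nth U 0"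
    using 1 2 arg_cong[OF eq, of "\<lambda>F. fps_nth F 1"] 0[symmetric] by (simp add: algebra_simps)
  thus "fps_nth P 1 * fps_nth U 0 = fps_nth a 1 + fps_nth b 0"
    using U0 by (simp add: power2_eq_square)
qed

text \<open>The factor \<open>X^3\<close> makes both sides power series, namely
  \<open>(V - U) P^2 = a (X P' - 2 P) + b X P\<close>. In the constant term neither \<open>b\<close>
  nor a higher coefficient of \<open>P\<close> survives.\<close>

lemma double_pole_delay_term_coeff:
  fixes a b P U V :: "complex fps"
  assumes "delay_term a b (fps_to_fls P / fls_X^2) = fls_X * fps_to_fls V - fls_X * fps_to_fls U"
    and P0: "fps_nth P 0 \<noteq> 0"
  shows "(fps_nth V 0 - fps_nth U 0) * fps_nth P 0 = - 2 * fps_nth a 0"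
proof -
  let ?p = "fps_to_fls P / fls_X^2"
  have nz: "?p \<noteq> 0"
    using P0 by (metis divide_eq_0_iff fls_X_nonzero fps_nonzeroI fps_to_fls_eq_0_iff power_not_zero)
  have px: "?p * fls_X^2 = fps_to_fls P"
    by (metis fls_X_nonzero nonzero_divide_eq_eq power_not_zero)
  have "fls_deriv (q * fls_X^2) = fls_deriv q * fls_X^2 + q * (2 * fls_X)" for q :: "complex fls"
    by (simp add: power2_eq_square algebra_simps)
  note this[of ?p]
  hence d: "fls_deriv ?p * fls_X^2 + ?p * (2 * fls_X) = fls_deriv (fps_to_fls P)"
    unfolding px by simp
  have "(fls_X * fps_to_fls V - fls_X * fps_to_fls U) * ?p^2
         = fps_to_fls a * fls_deriv ?p + fps_to_fls b * ?p"
    using assms(1) delay_term_eq_iff[OF nz] by simp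
  hence "(fls_X * fps_to_fls V - fls_X * fps_to_fls U) * ?p^2 * fls_X^3
         = (fps_to_fls a * fls_deriv ?p + fps_to_fls b * ?p) * fls_X^3"
    by simp
  also have "(fls_X * fps_to_fls V - fls_X * fps_to_fls U) * ?p^2 * fls_X^3
     = (fps_to_fls V - fps_to_fls U) * (?p * fls_X^2)^2"
  proof -
    have "(X * v - X * u) * p^2 * X^3 = (v - u) * (p * X^2)^2" for X v u p :: "complex fls"
      by (simp add: algebra_simps power2_eq_square power3_eq_cube)
    thus ?thesis .
  qed
  also have "\<dots> = fps_to_fls ((V - U) * P^2)"
    unfolding px by (simp add: fls_times_fps_to_fls fps_to_fls_power)
  also have "(fps_to_fls a * fls_deriv ?p + fps_to_fls b * ?p) * fls_X^3
     = fps_to_fls a * (fls_X * (fls_deriv ?p * fls_X^2 + ?p * (2 * fls_X)) - 2 * (?p * fls_X^2))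
        + fps_to_fls b * fls_X * (?p * fls_X^2)"
  proof -
    have "(a * d + b * p) * X^3 = a * (X * (d * X^2 + p * (2 * X)) - 2 * (p * X^2)) + b * X * (p * X^2)"
      for a b d p X :: "complex fls"
      by (simp add: algebra_simps power2_eq_square power3_eq_cube)
    thus ?thesis .
  qed
  also have "\<dots> = fps_to_fls (a * (fps_X * fps_deriv P - 2 * P) + b * fps_X * P)"
    unfolding d px by (simp add: fls_times_fps_to_fls fls_deriv_fps_to_fls)
  finally have "(V - U) * P^2 = a * (fps_X * fps_deriv P - 2 * P) + b * fps_X * P"
    by (simp only: fps_to_fls_eq_iff)
  hence "fps_nth ((V - U) * P^2) 0 = fps_nth (a * (fps_X * fps_deriv P - 2 * P) + b * fps_X * P) 0"
    by simp
  hence "(fps_nth V 0 - fps_nth U 0) * fps_nth P 0 * fps_nth P 0 = - 2 * fps_nth a 0 * fps_nth P 0"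
    by (simp add: power2_eq_square mult.assoc mult.left_commute mult.commute)
  thus ?thesis using P0 mult_right_cancel by blast
qed

text \<open>Here \<open>u\<close>, \<open>p\<close>, \<open>v\<close> stand for the expansions at z
  - 1, z, z + 1 and \<open>x\<close>, \<open>y\<close> for those at z - 2, z + 2, all in one local
  variable and with \<open>c = 0\<close>. The products \<open>P_0 U_0\<close>,
  \<open>P_0 V_0\<close> and their difference are all known, which gives the first relation;
  computing \<open>P_0 P_1 U_0 V_0\<close> in two ways gives the second.\<close>

lemma double_pole_between_zeros:
  fixes am bm a b ap bp :: "complex fps" and u v p x y :: "complex fls"
  assumes E: "delay_term am bm u = p - x" "delay_term a b p = v - u" "delay_term ap bp v = y - p"
    and u: "u \<noteq> 0" "fls_subdegree u > 0" and v: "v \<noteq> 0" "fls_subdegree v > 0"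
    and p: "fls_subdegree p = -2" and xy: "fls_subdegree x \<ge> 0" "fls_subdegree y \<ge> 0"
    and a0: "fps_nth am 0 \<noteq> 0" "fps_nth ap 0 \<noteq> 0"
  shows "fps_nth ap 0 + fps_nth am 0 = 2 * fps_nth a 0"
    and "(fps_nth am 1 + fps_nth bm 0) * fps_nth ap 0 = (fps_nth ap 1 + fps_nth bp 0) * fps_nth am 0"
proof -
  have p0: "p \<noteq> 0" using p by auto
  have dif: "fls_subdegree (p - z) = -2" if "fls_subdegree z \<ge> 0" for z
    using that p p0 by (subst fls_subdegree_diff_eq1) auto
  \<comment> \<open>\<open>p - x\<close> has order -2, while the delay term at a zero of order n has
    order - n - 1; hence the zero is simple.\<close>
  have "fls_subdegree u = 1"
    using delay_term_subdegree(2)[OF u(1) _ a0(1), of bm] dif[OF xy(1)] E(1) u by auto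
  then obtain U where U: "u = fls_X * fps_to_fls U" "fps_nth U 0 \<noteq> 0"
    using fls_factor_X_power[of u 1] u(1) by auto
  have "fls_subdegree v = 1"
    using delay_term_subdegree(2)[OF v(1) _ a0(2), of bp] dif[OF xy(2)] E(3) v
    by (metis fls_subdegree_minus_sym diff_minus_eq_add minus_diff_eq neg_equal_iff_equal
        add.commute add_left_imp_eq less_irrefl one_add_one uminus_add_conv_diff)
  then obtain V where V: "v = fls_X * fps_to_fls V" "fps_nth V 0 \<noteq> 0"
    using fls_factor_X_power[of v 1] v(1) by auto
  obtain P where P: "p = fps_to_fls P / fls_X^2" "fps_nth P 0 \<noteq> 0"
  proof -
    obtain P where "p = fls_X powi (-2) * fps_to_fls P" "fps_nth P 0 \<noteq> 0"
      using fls_factor_X_power[OF p p0] by blast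
    moreover have "fls_X powi (-2) * fps_to_fls P = fps_to_fls P / fls_X^2"
      by (simp only: power_int_minus power_int_numeral divide_inverse mult.commute)
    ultimately show ?thesis using that by simp
  qed
  obtain X where X: "x = fps_to_fls X" using fls_subdegree_nonneg_obtain xy(1) by metis
  obtain Y where Y: "y = fps_to_fls Y" using fls_subdegree_nonneg_obtain xy(2) by metis
  have 1: "fps_nth P 0 * fps_nth U 0 = fps_nth am 0" "fps_nth P 1 * fps_nth U 0 = fps_nth am 1 + fps_nth bm 0"
    using zero_of_delay_term_coeffs[of am bm U P X] E(1) U P X by auto
  \<comment> \<open>At z + 1 the double pole lies on the other side; changing the signs of the
    coefficients restores the situation at z - 1.\<close>
  have "delay_term (-ap) (-bp) v = p - y"
    using E(3) by (simp add: delay_term_uminus)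
  hence 2: "fps_nth P 0 * fps_nth V 0 = - fps_nth ap 0" "fps_nth P 1 * fps_nth V 0 = - (fps_nth ap 1 + fps_nth bp 0)"
    using zero_of_delay_term_coeffs[of "-ap" "-bp" V P Y] V P Y by auto
  have 3: "(fps_nth V 0 - fps_nth U 0) * fps_nth P 0 = - 2 * fps_nth a 0"
    using double_pole_delay_term_coeff[of a b P V U] E(2) U V P by auto
  show "fps_nth ap 0 + fps_nth am 0 = 2 * fps_nth a 0"
    using 1(1) 2(1) 3 by (simp add: algebra_simps)
  have "(fps_nth am 1 + fps_nth bm 0) * - fps_nth ap 0 = (fps_nth P 1 * fps_nth U 0) * (fps_nth P 0 * fps_nth V 0)"
    using 1 2 by simp
  also have "\<dots> = (fps_nth P 0 * fps_nth U 0) * (fps_nth P 1 * fps_nth V 0)" by simp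
  also have "\<dots> = fps_nth am 0 * - (fps_nth ap 1 + fps_nth bp 0)" using 1 2 by simp
  finally show "(fps_nth am 1 + fps_nth bm 0) * fps_nth ap 0 = (fps_nth ap 1 + fps_nth bp 0) * fps_nth am 0"
    by (simp add: algebra_simps)
qed

section \<open>Growth outside sets of finite logarithmic measure\<close>

text \<open>Counting functions are monotone but discontinuous; the second mean value theorem
  delivers integrability of the product as part of its conclusion.\<close>

lemma integrable_increasing_mult:
  fixes f g :: "real \<Rightarrow> real"
  assumes "f integrable_on {a..b}" and "\<And>x y. a \<le> x \<Longrightarrow> x \<le> y \<Longrightarrow> y \<le> b \<Longrightarrow> g x \<le> g y"
  shows "(\<lambda>x. g x * f x) integrable_on {a..b}"
proof (cases "a \<le> b")
  case True
  obtain c where "((\<lambda>x. g x * f x) has_integral (g a * integral {a..c} f + g b * integral {c..b} f)) {a..b}"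
    by (rule second_mean_value_theorem_full[OF assms(1) True assms(2)]) auto
  thus ?thesis by (rule has_integral_integrable)
qed auto

lemma has_integral_inverse_ln:
  fixes a b :: real
  assumes "a > 0" and "a \<le> b"
  shows "((\<lambda>t. c / t) has_integral c * (ln b - ln a)) {a..b}"
proof -
  have "((\<lambda>t. 1 / t) has_integral (ln b - ln a)) {a..b}"
    using assms by (intro fundamental_theorem_of_calculus)
      (auto intro!: derivative_eq_intros simp: has_real_derivative_iff_has_vector_derivative[symmetric] divide_inverse)
  from has_integral_mult_right[OF this, of c] show ?thesis by simp
qed

text \<open>Translates the Lebesgue integral of the definition into gauge integrals, in which all
  later estimates are made. \<open>M\<close> is the logarithmic measure of \<open>E\<close> beyond 1
  and serves every interval at once.\<close>

lemma finite_log_measure_integral: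
  assumes "finite_log_measure E"
  obtains M where "\<And>a b. 1 \<le> a \<Longrightarrow> (\<lambda>r. if r \<in> E then 1 / r else 0) integrable_on {a..b}"
    and "\<And>a b. 1 \<le> a \<Longrightarrow> integral {a..b} (\<lambda>r. if r \<in> E then 1 / r else 0) \<le> M"
proof -
  define h :: "real \<Rightarrow> real" where "h = (\<lambda>r. if r \<in> E \<inter> {1..} then 1 / r else 0)"
  have E: "E \<inter> {1..} \<in> sets lebesgue"
    using assms by (auto simp: finite_log_measure_def)
  have meas: "h \<in> lebesgue \<rightarrow>\<^sub>M borel"
    unfolding h_def
  proof (intro measurable_If_set)
    show "(\<lambda>r. 1 / r) \<in> borel_measurable (lebesgue :: real measure)"
      by (intro measurable_completion) (simp add: borel_measurable_divide)
  qed (use E in auto)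
  have "(\<integral>\<^sup>+r. ennreal (h r) \<partial>lebesgue) = (\<integral>\<^sup>+r\<in>E \<inter> {1..}. ennreal (1 / r) \<partial>lebesgue)"
    by (intro nn_integral_cong) (auto simp: h_def indicator_def)
  also have "\<dots> < \<infinity>"
    using assms by (auto simp: finite_log_measure_def)
  finally obtain M where M: "(\<integral>\<^sup>+r. ennreal (h r) \<partial>lebesgue) = ennreal M" "0 \<le> M"
    by (cases "\<integral>\<^sup>+r. ennreal (h r) \<partial>lebesgue" rule: ennreal_cases) auto
  have hpos: "0 \<le> h r" for r by (auto simp: h_def)
  have H: "(h has_integral M) UNIV"
    using has_integral_iff_nn_integral_lebesgue[of h M] meas M hpos by auto
  have int: "h integrable_on {a..b}" for a b
    using H integrable_on_subinterval[of h UNIV a b] by (auto simp: integrable_on_def)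
  have le: "integral {a..b} h \<le> M" for a b
    using integral_subset_le[of "{a..b}" UNIV h] int H hpos
    by (auto simp: has_integral_iff)
  show ?thesis
  proof
    fix a b :: real assume a: "1 \<le> a"
    show "(\<lambda>r. if r \<in> E then 1 / r else 0) integrable_on {a..b}"
      by (rule integrable_eq[OF int[of a b]]) (use a in \<open>auto simp: h_def\<close>)
    have "integral {a..b} (\<lambda>r. if r \<in> E then 1 / r else 0) = integral {a..b} h"
      by (intro integral_cong) (use a in \<open>auto simp: h_def\<close>)
    thus "integral {a..b} (\<lambda>r. if r \<in> E then 1 / r else 0) \<le> M"
      using le[of a b] by simp
  qed
qed

text \<open>Averaging the increments \<open>L (r + 1) - L r\<close> against \<open>dr / r\<close> gives a logarithmically divergent
  lower bound, while the left-hand side nearly telescopes because \<open>L\<close> grows more slowly than a power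
  with exponent below one.\<close>

lemma unit_step_growth_contradiction:
  fixes L :: "real \<Rightarrow> real"
  assumes E: "finite_log_measure E" and e: "e > 0" and s: "s < 1" and R: "R \<ge> 1"
    and mono: "\<And>x y. R \<le> x \<Longrightarrow> x \<le> y \<Longrightarrow> L x \<le> L y"
    and nonneg: "\<And>x. R \<le> x \<Longrightarrow> 0 \<le> L x"
    and bound: "\<And>x. R \<le> x \<Longrightarrow> L x \<le> x powr s"
    and step: "\<And>x. R \<le> x \<Longrightarrow> x \<notin> E \<Longrightarrow> L x + e \<le> L (x + 1)"
  shows False
proof -
  obtain M where hi: "\<And>a b. 1 \<le> a \<Longrightarrow> (\<lambda>r. if r \<in> E then 1 / r else 0) integrable_on {a..b}"
    and hM: "\<And>a b. 1 \<le> a \<Longrightarrow> integral {a..b} (\<lambda>r. if r \<in> E then 1 / r else 0) \<le> M"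
    using finite_log_measure_integral[OF E] by metis
  define h where "h = (\<lambda>r::real. if r \<in> E then 1 / r else 0)"
  \<comment> \<open>\<open>g\<close> and \<open>k\<close> satisfy
    \<open>(L (r + 1) - L r) / r = g (r + 1) - g r + k r\<close>: a telescoping part plus the error
    of replacing \<open>1 / r\<close> by \<open>1 / (r + 1)\<close>.\<close>
  define g where "g = (\<lambda>r. L r * (1 / r))"
  define k where "k = (\<lambda>r. L (r + 1) * (1 / (r * (r + 1))))"
  have M0: "M \<ge> 0" using hM[of 2 1] by simp
  \<comment> \<open>Chosen so that \<open>e * (ln Y - ln R - M)\<close> equals
    \<open>2 + 1 / (1 - s)\<close>, one more than the upper bound derived below.\<close>
  define Y where "Y = exp (ln R + M + (2 + 1 / (1 - s)) / e)"
  have Y: "ln Y = ln R + M + (2 + 1 / (1 - s)) / e" "Y > 0" by (simp_all add: Y_def)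
  have "ln Y > ln R" using M0 e s Y(1) by (simp add: add_pos_pos add_nonneg_pos)
  hence RY: "R < Y" using R Y(2) by simp
  have gi: "g integrable_on {a..b}" if "R \<le> a" for a b
  proof (cases "a \<le> b")
    case True
    have "(\<lambda>r. 1 / r) integrable_on {a..b}"
      using that R by (intro integrable_continuous_interval continuous_intros) auto
    from integrable_increasing_mult[OF this, of L] show ?thesis
      using mono that by (auto simp: g_def)
  qed auto
  have ki: "k integrable_on {R..Y}"
  proof -
    have "(\<lambda>r. 1 / (r * (r + 1))) integrable_on {R..Y}"
      using R by (intro integrable_continuous_interval continuous_intros) auto
    from integrable_increasing_mult[OF this, of "\<lambda>r. L (r + 1)"] show ?thesis
      using mono by (auto simp: k_def)
  qed
  have gsi: "(\<lambda>r. g (r + 1)) integrable_on {R..Y}"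
    using integrable_shift_real_ivl[OF gi[of "R + 1" "Y + 1"], of 1] by simp
  have gs: "integral {R..Y} (\<lambda>r. g (r + 1)) = integral {R+1..Y+1} g"
    using integral_shift_real_ivl[of "R+1" 1 "Y+1" g] by simp
  have li: "((\<lambda>r. 1 / r) has_integral (ln Y - ln R)) {R..Y}"
    using has_integral_inverse_ln[of R Y 1] RY R by simp
  have pw: "((\<lambda>r. r powr (s - 2)) has_integral (Y powr (s - 1) / (s - 1) - R powr (s - 1) / (s - 1))) {R..Y}"
    using RY R s by (intro fundamental_theorem_of_calculus)
      (auto intro!: derivative_eq_intros simp: has_real_derivative_iff_has_vector_derivative[symmetric])
  have g1: "0 \<le> g r" "g r \<le> 1" if "R \<le> r" for r
  proof -
    show "0 \<le> g r" using nonneg[OF that] that R by (simp add: g_def)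
    have "L r \<le> r powr 1"
      using bound[OF that] powr_mono[of s 1 r] s R that by linarith
    thus "g r \<le> 1" using that R by (simp add: g_def)
  qed
  \<comment> \<open>The exponent is below -1 because \<open>s < 1\<close>, so the error integral
    stays bounded however large \<open>Y\<close> is.\<close>
  have k1: "k r \<le> r powr (s - 2)" if "R \<le> r" for r
  proof -
    have "k r \<le> (r + 1) powr s * (1 / (r * (r + 1)))"
      unfolding k_def using bound[of "r + 1"] that R by (intro mult_right_mono) auto
    also have "\<dots> = (r + 1) powr (s - 1) / r"
      using that R by (simp add: powr_diff)
    also have "\<dots> \<le> r powr (s - 1) / r"
      using that R s by (intro divide_right_mono powr_mono2') auto
    also have "\<dots> = r powr (s - 2)"
      using that R powr_diff[of r "s - 1" 1] by simp
    finally show ?thesis .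
  qed
  have "(ln Y - ln R) - M \<le> integral {R..Y} (\<lambda>r. 1 / r) - integral {R..Y} h"
    using li hM[of R Y] R by (simp add: integral_unique h_def)
  also have "\<dots> = integral {R..Y} (\<lambda>r. 1 / r - h r)"
    using li hi[OF R, of Y] by (subst integral_diff) (auto simp: h_def)
  finally have "e * ((ln Y - ln R) - M) \<le> e * integral {R..Y} (\<lambda>r. 1 / r - h r)"
    using e by (intro mult_left_mono) auto
  also have "\<dots> = integral {R..Y} (\<lambda>r. e * (1 / r - h r))"
    by simp
  also have "\<dots> \<le> integral {R..Y} (\<lambda>r. g (r + 1) - g r + k r)"
  proof (intro integral_le)
    show "(\<lambda>r. e * (1 / r - h r)) integrable_on {R..Y}"
      using li hi[OF R, of Y] by (intro integrable_on_mult_right integrable_diff) (auto simp: h_def)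
    show "(\<lambda>r. g (r + 1) - g r + k r) integrable_on {R..Y}"
      using gsi gi ki by (intro integrable_add integrable_diff) auto
    fix r assume r: "r \<in> {R..Y}"
    have "e * (1 / r - h r) \<le> (L (r + 1) - L r) / r"
    proof (cases "r \<in> E")
      case True
      thus ?thesis using r R mono[of r "r + 1"] by (simp add: h_def)
    next
      case False
      have "e / r \<le> (L (r + 1) - L r) / r"
        using step[of r] False r R by (intro divide_right_mono) auto
      thus ?thesis using False by (simp add: h_def)
    qed
    also have "\<dots> = g (r + 1) - g r + k r"
      using r R by (simp add: g_def k_def divide_simps) (simp add: algebra_simps)
    finally show "e * (1 / r - h r) \<le> g (r + 1) - g r + k r" .
  qed
  also have "\<dots> = integral {R+1..Y+1} g - integral {R..Y} g + integral {R..Y} k"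
    using gsi gi ki by (simp add: integral_add integral_diff integrable_diff gs)
  \<comment> \<open>Only two end intervals of unit length survive the telescoping, and there
    \<open>0 \<le> g \<le> 1\<close>.\<close>
  also have "integral {R+1..Y+1} g - integral {R..Y} g = integral {Y..Y+1} g - integral {R..R+1} g"
    using Henstock_Kurzweil_Integration.integral_combine[of R Y "Y+1" g] RY gi[of R]
      Henstock_Kurzweil_Integration.integral_combine[of R "R+1" "Y+1" g] by simp
  also have "\<dots> \<le> 1"
  proof -
    have "integral {Y..Y+1} g \<le> integral {Y..Y+1} (\<lambda>_. 1)"
      using gi RY g1 by (intro integral_le) auto
    moreover have "0 \<le> integral {R..R+1} g"
      using gi g1 by (intro integral_nonneg) auto
    ultimately show ?thesis by simp
  qed
  also have "integral {R..Y} k \<le> 1 / (1 - s)"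
  proof -
    have "integral {R..Y} k \<le> integral {R..Y} (\<lambda>r. r powr (s - 2))"
      using ki pw k1 by (intro integral_le) auto
    also have "\<dots> = (R powr (s - 1) - Y powr (s - 1)) / (1 - s)"
      using pw s by (simp add: integral_unique divide_simps) (simp add: algebra_simps)
    also have "\<dots> \<le> 1 / (1 - s)"
    proof (intro divide_right_mono)
      have "R powr (s - 1) \<le> 1" using powr_mono2'[of "s - 1" 1 R] R s by simp
      moreover have "0 \<le> Y powr (s - 1)" by simp
      ultimately show "R powr (s - 1) - Y powr (s - 1) \<le> 1" by linarith
    qed (use s in auto)
    finally show ?thesis .
  qed
  finally have "e * ((ln Y - ln R) - M) \<le> 1 + 1 / (1 - s)" by simp
  moreover have "e * ((ln Y - ln R) - M) = 2 + 1 / (1 - s)"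
    using Y e by simp
  ultimately show False by simp
qed

section \<open>Integrated counting functions\<close>

text \<open>Constancy near 0 makes \<open>(n t - n 0) / t\<close> vanish there, so the integral
  defining the integrated count exists at its lower end; monotonicity provides integrability
  elsewhere.\<close>

definition counting_function :: "(real \<Rightarrow> nat) \<Rightarrow> bool" where
  "counting_function n \<longleftrightarrow>
     (\<forall>x y. 0 \<le> x \<longrightarrow> x \<le> y \<longrightarrow> n x \<le> n y) \<and> (\<exists>d>0. \<forall>t. 0 \<le> t \<longrightarrow> t < d \<longrightarrow> n t = n 0)"

lemma counting_function_mono: "counting_function n \<Longrightarrow> 0 \<le> x \<Longrightarrow> x \<le> y \<Longrightarrow> n x \<le> n y"
  by (auto simp: counting_function_def)

lemma counting_function_integrable:
  assumes "counting_function n" and "a > 0"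
  shows "(\<lambda>t. real (n t) / t) integrable_on {a..b}"
proof -
  have "(\<lambda>t. 1 / t) integrable_on {a..b}"
    using assms by (intro integrable_continuous_interval continuous_intros) auto
  from integrable_increasing_mult[OF this, of "\<lambda>t. real (n t)"] show ?thesis
    using assms counting_function_mono[of n] by auto
qed

text \<open>For radii at least 1 the term \<open>n 0 * ln r\<close> is the integral of
  \<open>n 0 / t\<close> over \<open>{1..r}\<close> and merges with the remaining integral; what
  happens on \<open>{0..1}\<close> is the constant.\<close>

lemma integrated_count_eq:
  assumes n: "counting_function n"
  shows "\<exists>C. \<forall>r\<ge>1. integrated_count n r = C + integral {1..r} (\<lambda>t. real (n t) / t)"
proof (intro exI allI impI)
  define f where "f = (\<lambda>t. (real (n t) - real (n 0)) / t)"
  obtain d where d: "d > 0" "\<And>t. 0 \<le> t \<Longrightarrow> t < d \<Longrightarrow> n t = n 0"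
    using n by (auto simp: counting_function_def)
  fix r :: real assume r: "1 \<le> r"
  define c where "c = min 1 (d / 2)"
  have c: "0 < c" "c \<le> 1" "c < d" using d by (auto simp: c_def)
  have f1: "f integrable_on {0..c}"
  proof (rule integrable_eq[OF integrable_0])
    fix t assume "t \<in> {0..c}"
    hence "n t = n 0" using c by (intro d(2)) auto
    thus "0 = f t" by (simp add: f_def)
  qed
  have fi: "f integrable_on {a..b}" if "a > 0" for a b
  proof -
    have "(\<lambda>t. real (n t) / t - real (n 0) / t) integrable_on {a..b}"
      using that counting_function_integrable[OF n that]
      by (intro integrable_diff integrable_continuous_interval[of _ _ "\<lambda>t. real (n 0) / t"] continuous_intros) auto
    thus ?thesis by (simp add: f_def diff_divide_distrib)
  qed
  have f0: "f integrable_on {0..r}"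
    using Henstock_Kurzweil_Integration.integrable_combine[of 0 c r f] f1 fi[of c r] c r by auto
  have "integral {1..r} f = integral {1..r} (\<lambda>t. real (n t) / t) - integral {1..r} (\<lambda>t. real (n 0) / t)"
    using counting_function_integrable[OF n, of 1 r] has_integral_inverse_ln[of 1 r "real (n 0)"] r
    by (simp add: f_def diff_divide_distrib integral_diff has_integral_integrable)
  also have "integral {1..r} (\<lambda>t. real (n 0) / t) = real (n 0) * ln r"
    using has_integral_inverse_ln[of 1 r "real (n 0)"] r by (simp add: integral_unique)
  finally show "integrated_count n r = integral {0..1} f + integral {1..r} (\<lambda>t. real (n t) / t)"
    using Henstock_Kurzweil_Integration.integral_combine[of 0 1 r f] f0 r
    by (simp add: integrated_count_def f_def)
qed

lemma integrated_count_mono: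
  assumes n: "counting_function n" and "1 \<le> x" and "x \<le> y"
  shows "integrated_count n x \<le> integrated_count n y"
proof -
  obtain C where C: "\<forall>r\<ge>1. integrated_count n r = C + integral {1..r} (\<lambda>t. real (n t) / t)"
    using integrated_count_eq[OF n] by blast
  have "integral {1..x} (\<lambda>t. real (n t) / t) \<le> integral {1..y} (\<lambda>t. real (n t) / t)"
    using assms counting_function_integrable[OF n] by (intro integral_subset_le) auto
  thus ?thesis using C assms by simp
qed

lemma integrated_count_nonneg:
  assumes n: "counting_function n" and r: "1 \<le> r"
  shows "0 \<le> integrated_count n r"
proof -
  have "0 \<le> integral {0..r} (\<lambda>t. (real (n t) - real (n 0)) / t)"
  proof (cases "(\<lambda>t. (real (n t) - real (n 0)) / t) integrable_on {0..r}")
    case True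
    thus ?thesis using counting_function_mono[OF n, of 0] by (intro integral_nonneg) auto
  qed (simp add: not_integrable_integral)
  thus ?thesis using r by (simp add: integrated_count_def)
qed

text \<open>Once \<open>n\<close> has reached \<open>K + 1\<close>, the integral grows at least like
  \<open>(K + 1) * ln r\<close>, and the surplus \<open>ln r\<close> swallows the constants.\<close>

lemma integrated_count_dominates_ln:
  assumes n: "counting_function n" and unb: "\<And>k. \<exists>r\<ge>0. k \<le> n r"
  shows "\<forall>\<^sub>F r in at_top. K * ln r \<le> integrated_count n r"
proof -
  obtain C where C: "\<forall>r\<ge>1. integrated_count n r = C + integral {1..r} (\<lambda>t. real (n t) / t)"
    using integrated_count_eq[OF n] by blast
  define m where "m = nat \<lceil>\<bar>K\<bar> + 1\<rceil>"
  obtain r1 where r1: "r1 \<ge> 0" "m \<le> n r1" using unb by blast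
  define r0 where "r0 = max 1 r1"
  have r01: "r0 \<ge> 1" by (simp add: r0_def)
  have r0: "real m \<le> real (n t)" if "t \<ge> r0" for t
    using counting_function_mono[OF n, of r1 t] that r1 by (simp add: r0_def)
  have mK: "real m \<ge> K + 1" unfolding m_def by linarith
  have ge: "C + (K + 1) * (ln r - ln r0) \<le> integrated_count n r" if r: "r \<ge> r0" for r
  proof -
    have "(K + 1) * (ln r - ln r0) \<le> real m * (ln r - ln r0)"
      using mK r r01 by (intro mult_right_mono) auto
    also have "\<dots> = integral {r0..r} (\<lambda>t. real m / t)"
      using has_integral_inverse_ln[of r0 r "real m"] r r01 by (simp add: integral_unique)
    also have "\<dots> \<le> integral {r0..r} (\<lambda>t. real (n t) / t)"
      using has_integral_inverse_ln[of r0 r "real m"] r r01 r0 counting_function_integrable[OF n, of r0 r]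
      by (intro integral_le divide_right_mono) (auto simp: has_integral_integrable)
    also have "\<dots> \<le> integral {1..r} (\<lambda>t. real (n t) / t)"
      using r r01 counting_function_integrable[OF n] by (intro integral_subset_le) auto
    finally show ?thesis using C r r01 by auto
  qed
  have "\<forall>\<^sub>F r in at_top. (K + 1) * ln r0 - C \<le> ln r"
    using ln_at_top by (auto simp: filterlim_at_top)
  moreover have "\<forall>\<^sub>F r in at_top. r0 \<le> r" by (rule eventually_ge_at_top)
  ultimately show ?thesis
  proof eventually_elim
    case (elim r)
    thus ?case using ge[of r] by (simp add: algebra_simps)
  qed
qed

text \<open>\<open>1 / t \<le> (1 + d) / (t + 1)\<close> as soon as \<open>t \<ge> 1 / d\<close>, so
  after substituting t + 1 the shift of the radius costs only the factor \<open>1 + d\<close>;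
  smaller t go into the constant.\<close>

lemma integrated_count_shift_le:
  assumes n: "counting_function n" and m: "counting_function m"
    and le: "\<And>t. 0 \<le> t \<Longrightarrow> real (m t) \<le> \<alpha> * real (n (t + 1)) + K"
    and \<alpha>: "\<alpha> \<ge> 0" and K: "K \<ge> 0" and d: "d > 0"
  shows "\<exists>C. \<forall>\<^sub>F r in at_top. integrated_count m r \<le> \<alpha> * (1 + d) * integrated_count n (r + 1) + K * ln r + C"
proof -
  obtain Cn where Cn: "\<forall>r\<ge>1. integrated_count n r = Cn + integral {1..r} (\<lambda>t. real (n t) / t)"
    using integrated_count_eq[OF n] by blast
  obtain Cm where Cm: "\<forall>r\<ge>1. integrated_count m r = Cm + integral {1..r} (\<lambda>t. real (m t) / t)"
    using integrated_count_eq[OF m] by blast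
  define t0 where "t0 = max 1 (1 / d)"
  have t0: "t0 \<ge> 1" "t0 \<ge> 1 / d" by (auto simp: t0_def)
  define C1 where "C1 = Cm + integral {1..t0} (\<lambda>t. real (m t) / t)"
  have "integrated_count m r \<le> \<alpha> * (1 + d) * integrated_count n (r + 1) + K * ln r + (C1 - \<alpha> * (1 + d) * Cn)"
    if r: "r \<ge> t0" for r
  proof -
    have mi: "(\<lambda>t. real (m t) / t) integrable_on {a..b}" if "1 \<le> a" for a b
      using that by (intro counting_function_integrable m) auto
    have ni: "(\<lambda>t. real (n t) / t) integrable_on {a..b}" if "1 \<le> a" for a b
      using that by (intro counting_function_integrable n) auto
    have si: "(\<lambda>t. real (n (t + 1)) / (t + 1)) integrable_on {t0..r}"
      using integrable_shift_real_ivl[OF ni[of "t0 + 1" "r + 1"], of 1] t0 by simp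
    have Ki: "((\<lambda>t. K / t) has_integral K * (ln r - ln t0)) {t0..r}"
      using t0 r by (intro has_integral_inverse_ln) auto
    have "integrated_count m r = C1 + integral {t0..r} (\<lambda>t. real (m t) / t)"
      using Henstock_Kurzweil_Integration.integral_combine[of 1 t0 r "\<lambda>t. real (m t) / t"] mi[of 1 r] r t0 Cm
      by (simp add: C1_def)
    also have "integral {t0..r} (\<lambda>t. real (m t) / t)
       \<le> integral {t0..r} (\<lambda>t. \<alpha> * (1 + d) * (real (n (t + 1)) / (t + 1)) + K / t)"
    proof (intro integral_le mi t0(1) integrable_add integrable_on_mult_right si has_integral_integrable[OF Ki])
      fix t assume t: "t \<in> {t0..r}"
      have tp: "t > 0" "1 / d \<le> t" using t t0 by auto
      hence "t + 1 \<le> (1 + d) * t" using d by (simp add: field_simps)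
      hence i: "1 / t \<le> (1 + d) / (t + 1)" using tp by (simp add: field_simps)
      have "real (m t) / t \<le> (\<alpha> * real (n (t + 1)) + K) / t"
        using le[of t] tp by (intro divide_right_mono) auto
      also have "\<dots> = \<alpha> * real (n (t + 1)) * (1 / t) + K / t"
        by (simp add: add_divide_distrib)
      also have "\<dots> \<le> \<alpha> * real (n (t + 1)) * ((1 + d) / (t + 1)) + K / t"
        using i \<alpha> by (intro add_right_mono mult_left_mono) auto
      finally show "real (m t) / t \<le> \<alpha> * (1 + d) * (real (n (t + 1)) / (t + 1)) + K / t"
        by (simp add: mult_ac)
    qed
    also have "\<dots> = \<alpha> * (1 + d) * integral {t0..r} (\<lambda>t. real (n (t + 1)) / (t + 1)) + K * (ln r - ln t0)"
      by (simp only: integral_add[OF integrable_on_mult_right[OF si] has_integral_integrable[OF Ki]]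
          integral_unique[OF Ki] integral_mult_right)
    also have "integral {t0..r} (\<lambda>t. real (n (t + 1)) / (t + 1)) = integral {t0+1..r+1} (\<lambda>t. real (n t) / t)"
      using integral_shift_real_ivl[of "t0+1" 1 "r+1" "\<lambda>t. real (n t) / t"] by simp
    also have "\<alpha> * (1 + d) * \<dots> \<le> \<alpha> * (1 + d) * (integrated_count n (r + 1) - Cn)"
    proof (intro mult_left_mono)
      have "integral {t0+1..r+1} (\<lambda>t. real (n t) / t) \<le> integral {1..r+1} (\<lambda>t. real (n t) / t)"
        using t0 r by (intro integral_subset_le ni) auto
      thus "integral {t0+1..r+1} (\<lambda>t. real (n t) / t) \<le> integrated_count n (r + 1) - Cn"
        using Cn r t0 by auto
    qed (use \<alpha> d in auto)
    also have "K * (ln r - ln t0) \<le> K * ln r"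
      using K t0 by (intro mult_left_mono) auto
    finally show ?thesis by (simp add: algebra_simps)
  qed
  thus ?thesis by (auto simp: eventually_at_top_linorder)
qed

text \<open>The guard \<open>1 < T r\<close> makes \<open>ln (T r)\<close> positive, so that
  \<open>exp\<close> inverts the outer logarithm.\<close>

lemma hyper_order_less_one_bound:
  assumes "Limsup at_top (\<lambda>r. ereal (ln (ln (T r)) / ln r)) < 1"
  shows "\<exists>s<1. \<forall>\<^sub>F r in at_top. 1 < T r \<longrightarrow> ln (T r) \<le> r powr s"
proof -
  obtain s where s: "Limsup at_top (\<lambda>r. ereal (ln (ln (T r)) / ln r)) < ereal s" "ereal s < 1"
    using ereal_dense2[OF assms] by blast
  have "\<forall>\<^sub>F r in at_top. ereal (ln (ln (T r)) / ln r) < ereal s"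
    using s(1) by (rule Limsup_lessD)
  moreover have "\<forall>\<^sub>F r::real in at_top. r > 1" by (rule eventually_gt_at_top)
  ultimately have "\<forall>\<^sub>F r in at_top. 1 < T r \<longrightarrow> ln (T r) \<le> r powr s"
  proof eventually_elim
    case (elim r)
    show ?case
    proof
      assume T: "1 < T r"
      have "ln (ln (T r)) < s * ln r" using elim by (simp add: field_simps)
      hence "exp (ln (ln (T r))) < exp (s * ln r)" by simp
      thus "ln (T r) \<le> r powr s" using T elim by (simp add: powr_def)
    qed
  qed
  moreover have "s < 1" using s(2) by (simp add: one_ereal_def)
  ultimately show ?thesis by blast
qed

text \<open>Off \<open>E\<close> the inequalities chain to \<open>N (r + 1) \<ge> q * N r\<close>
  with a fixed \<open>q > 1\<close>. Then \<open>ln N\<close> rises by \<open>ln q\<close> in such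
  unit steps, while \<open>ln N \<le> ln T\<close> stays below a power of r with exponent less than
  1.\<close>

lemma integrated_count_contradiction:
  fixes \<epsilon> :: real
  assumes n: "counting_function n" and m: "counting_function m"
    and unb: "\<And>k. \<exists>r\<ge>0. k \<le> n r"
    and le: "\<And>t. 0 \<le> t \<Longrightarrow> real (m t) \<le> \<alpha> * real (n (t + 1)) + K"
    and \<alpha>: "\<alpha> > 0"
    and NT: "\<And>r. 1 \<le> r \<Longrightarrow> integrated_count n r \<le> T r"
    and hyper: "Limsup at_top (\<lambda>r. ereal (ln (ln (T r)) / ln r)) < 1"
    and E: "finite_log_measure E" and S: "S \<in> o[inf at_top (principal (- E))](T)"
    and \<epsilon>: "\<epsilon> > 0"
    and ge: "\<forall>\<^sub>F r in at_top. integrated_count m r \<ge> (\<alpha> + \<epsilon>) * T r + S r"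
  shows False
proof -
  define N where "N = integrated_count n"
  define K' where "K' = max K 0"
  \<comment> \<open>The budget: \<open>S\<close> takes half of \<epsilon>. The shift costs
    \<open>\<alpha> * d\<close> and the logarithmic error \<open>d\<close>, together a quarter of
    \<epsilon>. The last quarter is the gain that makes \<open>q > 1\<close>.\<close>
  define d where "d = \<epsilon> / (4 * (1 + \<alpha>))"
  have d: "d > 0" "\<alpha> * d + d = \<epsilon> / 4" using \<epsilon> \<alpha> by (auto simp: d_def divide_simps) (simp add: algebra_simps)
  have le': "real (m t) \<le> \<alpha> * real (n (t + 1)) + K'" if "0 \<le> t" for t
    using le[OF that] by (simp add: K'_def)
  have "\<exists>C. \<forall>\<^sub>F r in at_top. integrated_count m r \<le> \<alpha> * (1 + d) * integrated_count n (r + 1) + K' * ln r + C"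
    by (rule integrated_count_shift_le[OF n m le']) (use \<alpha> d in \<open>auto simp: K'_def\<close>)
  then obtain C where C: "\<forall>\<^sub>F r in at_top. integrated_count m r \<le> \<alpha> * (1 + d) * N (r + 1) + K' * ln r + C"
    by (auto simp: N_def)
  obtain s where s: "s < 1" "\<forall>\<^sub>F r in at_top. 1 < T r \<longrightarrow> ln (T r) \<le> r powr s"
    using hyper_order_less_one_bound[OF hyper] by blast
  have "\<forall>\<^sub>F r in inf at_top (principal (- E)). norm (S r) \<le> (\<epsilon> / 2) * norm (T r)"
    using landau_o.smallD[OF S, of "\<epsilon> / 2"] \<epsilon> by simp
  hence S': "\<forall>\<^sub>F r in at_top. r \<notin> E \<longrightarrow> \<bar>S r\<bar> \<le> (\<epsilon> / 2) * \<bar>T r\<bar>"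
    by (simp add: eventually_inf_principal)
  define q where "q = (\<alpha> + \<epsilon> / 2) / (\<alpha> + \<epsilon> / 4)"
  have q: "q > 1" using \<alpha> \<epsilon> by (simp add: q_def)
  \<comment> \<open>Any positive factor of this size would do: together with \<open>ln r > 1\<close>
    it yields \<open>N r > 1\<close>, hence positive logarithms.\<close>
  have ev2: "\<forall>\<^sub>F r in at_top. 3 * ln r \<le> N r"
    unfolding N_def by (rule integrated_count_dominates_ln[OF n unb])
  have ev3: "\<forall>\<^sub>F r in at_top. (K' + \<bar>C\<bar>) / d * ln r \<le> N r"
    unfolding N_def by (rule integrated_count_dominates_ln[OF n unb])
  have ev4: "\<forall>\<^sub>F r::real in at_top. r > 3" by (rule eventually_gt_at_top)
  have "\<forall>\<^sub>F r in at_top. r > 3 \<and> 1 < N r \<and> ln (N r) \<le> r powr s \<and> (r \<notin> E \<longrightarrow> ln (N r) + ln q \<le> ln (N (r + 1)))"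
    using C s(2) S' ev2 ev3 ev4 ge
  proof eventually_elim
    case (elim r)
    have r3: "r > 3" using elim by blast
    have ln1: "ln r > 1"
    proof -
      have "exp 1 < r" using r3 exp_le by linarith
      hence "ln (exp 1) < ln r" using r3 by (subst ln_less_cancel_iff) auto
      thus ?thesis by simp
    qed
    have N1: "N r > 1" using elim ln1 by linarith
    have TN: "N r \<le> T r" using NT r3 by (simp add: N_def)
    have "ln (N r) \<le> ln (T r)" using TN N1 by simp
    hence A: "ln (N r) \<le> r powr s" using elim N1 TN by linarith
    have "ln (N r) + ln q \<le> ln (N (r + 1))" if rE: "r \<notin> E"
    proof -
      have NN: "N r \<le> N (r + 1)"
        unfolding N_def using r3 by (intro integrated_count_mono n) auto
      have "\<bar>S r\<bar> \<le> (\<epsilon> / 2) * T r" using elim rE N1 TN by auto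
      hence "(\<alpha> + \<epsilon> / 2) * T r \<le> \<alpha> * (1 + d) * N (r + 1) + K' * ln r + C"
        using elim by (simp add: algebra_simps) 
      also have "\<dots> \<le> \<alpha> * (1 + d) * N (r + 1) + (K' + \<bar>C\<bar>) * ln r"
      proof -
        have "C \<le> \<bar>C\<bar> * 1" by simp
        also have "\<dots> \<le> \<bar>C\<bar> * ln r" using ln1 by (intro mult_left_mono) auto
        finally show ?thesis by (simp add: algebra_simps)
      qed
      also have "(K' + \<bar>C\<bar>) * ln r \<le> d * N (r + 1)"
      proof -
        have "(K' + \<bar>C\<bar>) / d * ln r \<le> N (r + 1)" using elim NN by linarith
        thus ?thesis using d by (simp add: field_simps)
      qed
      also have "\<alpha> * (1 + d) * N (r + 1) + d * N (r + 1) = (\<alpha> + (\<alpha> * d + d)) * N (r + 1)"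
        by (simp add: algebra_simps)
      also have "\<dots> = (\<alpha> + \<epsilon> / 4) * N (r + 1)" using d by simp
      finally have "(\<alpha> + \<epsilon> / 2) * T r \<le> (\<alpha> + \<epsilon> / 4) * N (r + 1)" by simp
      moreover have "(\<alpha> + \<epsilon> / 2) * N r \<le> (\<alpha> + \<epsilon> / 2) * T r"
        using TN \<alpha> \<epsilon> by (intro mult_left_mono) auto
      ultimately have "(\<alpha> + \<epsilon> / 2) * N r \<le> (\<alpha> + \<epsilon> / 4) * N (r + 1)" by linarith
      hence "q * N r \<le> N (r + 1)" using \<alpha> \<epsilon> by (simp add: q_def field_simps)
      hence "ln (q * N r) \<le> ln (N (r + 1))" using q N1 NN by (subst ln_le_cancel_iff) auto
      thus ?thesis using q N1 by (simp add: ln_mult)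
    qed
    thus ?case using r3 N1 A by blast
  qed
  then obtain R where R: "\<And>r. r \<ge> R \<Longrightarrow> r > 3 \<and> 1 < N r \<and> ln (N r) \<le> r powr s \<and>
      (r \<notin> E \<longrightarrow> ln (N r) + ln q \<le> ln (N (r + 1)))"
    by (auto simp: eventually_at_top_linorder)
  show False
  proof (rule unit_step_growth_contradiction[of E "ln q" s "max R 1" "\<lambda>r. ln (N r)"])
    fix x y :: real assume xy: "max R 1 \<le> x" "x \<le> y"
    have "N x \<le> N y" unfolding N_def using xy by (intro integrated_count_mono n) auto
    thus "ln (N x) \<le> ln (N y)" using R[of x] xy by auto
  next
    fix x :: real assume "max R 1 \<le> x"
    thus "0 \<le> ln (N x)" using R[of x] by simp
  qed (use E q s R in auto)
qed


text \<open>A set containing a half-line has infinite logarithmic measure; hence estimates off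
  \<open>E\<close> are available at arbitrarily large radii.\<close>

lemma finite_log_measure_unbounded_complement:
  assumes "finite_log_measure E"
  shows "\<exists>r\<ge>R. r \<notin> E"
proof (rule ccontr)
  assume "\<not> (\<exists>r\<ge>R. r \<notin> E)"
  hence inE: "r \<in> E" if "r \<ge> R" for r using that by blast
  obtain M where M: "\<And>a b. 1 \<le> a \<Longrightarrow> integral {a..b} (\<lambda>r. if r \<in> E then 1 / r else 0) \<le> M"
    using finite_log_measure_integral[OF assms] by metis
  define a where "a = max 1 R"
  define b where "b = exp (ln a + \<bar>M\<bar> + 1)"
  have a: "a \<ge> 1" "a \<ge> R" by (auto simp: a_def)
  have lb: "ln b = ln a + \<bar>M\<bar> + 1" "b > 0" by (simp_all add: b_def)
  have ab: "a < b" using lb a ln_less_cancel_iff[of a b] by linarith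
  have "integral {a..b} (\<lambda>r. if r \<in> E then 1 / r else 0) = integral {a..b} (\<lambda>r. 1 / r)"
    using inE a by (intro integral_cong) auto
  also have "\<dots> = ln b - ln a"
    using has_integral_inverse_ln[of a b 1] a ab by (simp add: integral_unique)
  finally show False using M[OF a(1), of b] lb by simp
qed

section \<open>Distributing zeros among adjacent poles\<close>

definition neighbours :: "complex set \<Rightarrow> complex \<Rightarrow> complex set" where
  "neighbours P z = {z - 1, z + 1} \<inter> P"

lemma finite_neighbours [simp]: "finite (neighbours P z)"
  by (simp add: neighbours_def)

lemma card_neighbours_eq_2: "z - 1 \<in> P \<Longrightarrow> z + 1 \<in> P \<Longrightarrow> card (neighbours P z) = 2"
proof -
  assume "z - 1 \<in> P" "z + 1 \<in> P"
  hence "neighbours P z = {z - 1, z + 1}" by (auto simp: neighbours_def)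
  moreover have "z - 1 \<noteq> z + 1" by (simp add: complex_eq_iff)
  ultimately show ?thesis by simp
qed

lemma inverse_card_neighbours_le_1: "1 / real (card (neighbours P z)) \<le> 1"
  by (cases "card (neighbours P z)") (simp_all add: field_simps)

text \<open>At \<open>p\<close> in \<open>P\<close> all denominators are positive, since
  \<open>p\<close> is itself a neighbour of every \<open>z\<close> in the sum; elsewhere the default
  \<open>1 / 0 = 0\<close> may occur.\<close>

definition load :: "complex set \<Rightarrow> complex set \<Rightarrow> complex \<Rightarrow> real" where
  "load Z P p = (\<Sum>z\<in>neighbours Z p. 1 / real (card (neighbours P z)))"

lemma load_le_card: "load Z P p \<le> real (card (neighbours Z p))"
proof -
  have "load Z P p \<le> (\<Sum>z\<in>neighbours Z p. 1)"
    unfolding load_def by (intro sum_mono inverse_card_neighbours_le_1)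
  thus ?thesis by simp
qed

lemma card_neighbours_le_2: "card (neighbours Z p) \<le> 2"
  unfolding neighbours_def
  by (rule order_trans[OF card_mono[of "{p - 1, p + 1}"]]) (auto simp: card_insert_if)

lemma card_neighbours_le_1:
  assumes "\<not> (p - 1 \<in> Z \<and> p + 1 \<in> Z)"
  shows "card (neighbours Z p) \<le> 1"
proof -
  have "neighbours Z p \<subseteq> {p - 1} \<or> neighbours Z p \<subseteq> {p + 1}"
    using assms by (auto simp: neighbours_def)
  thus ?thesis
    by (metis card.empty card_mono finite.emptyI finite.insertI is_singletonI is_singleton_altdef)
qed

lemma load_both:
  assumes "p - 1 \<in> Z" "p + 1 \<in> Z"
  shows "load Z P p = 1 / real (card (neighbours P (p - 1))) + 1 / real (card (neighbours P (p + 1)))"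
proof -
  have "neighbours Z p = {p - 1, p + 1}" using assms by (auto simp: neighbours_def)
  moreover have "p - 1 \<noteq> p + 1" by (simp add: complex_eq_iff)
  ultimately show ?thesis by (simp add: load_def)
qed

text \<open>Each \<open>z \<in> Z\<close> distributes a unit charge equally among the adjacent elements of \<open>P\<close>.\<close>

lemma card_le_sum_load:
  assumes finZ: "\<And>r. finite (Z \<inter> cball 0 r)" and finP: "\<And>r. finite (P \<inter> cball 0 r)"
    and nb: "\<And>z. z \<in> Z \<Longrightarrow> R \<le> norm z \<Longrightarrow> neighbours P z \<noteq> {}"
  shows "real (card (Z \<inter> cball 0 t)) \<le> (\<Sum>p\<in>P \<inter> cball 0 (t + 1). load Z P p) + real (card (Z \<inter> cball 0 R))"
proof -
  define Z' where "Z' = {z \<in> Z \<inter> cball 0 t. R \<le> norm z}"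
  define P' where "P' = P \<inter> cball 0 (t + 1)"
  have fin: "finite Z'" "finite P'"
    using finP by (auto simp: Z'_def P'_def intro: finite_subset[OF _ finZ[of t]])
  \<comment> \<open>Neighbours lie at distance 1, whence the radius \<open>t + 1\<close>: no charge
    of a point of \<open>Z'\<close> leaves the larger disc.\<close>
  have nbP: "neighbours P z = {p \<in> P'. p \<in> neighbours P z}" if "z \<in> Z'" for z
  proof -
    have "norm (z - 1) \<le> t + 1" "norm (z + 1) \<le> t + 1"
      using that norm_triangle_ineq4[of z 1] norm_triangle_ineq[of z 1] by (auto simp: Z'_def)
    thus ?thesis by (auto simp: neighbours_def P'_def)
  qed
  have "real (card Z') = (\<Sum>z\<in>Z'. 1)" by simp
  also have "\<dots> = (\<Sum>z\<in>Z'. \<Sum>p\<in>neighbours P z. 1 / real (card (neighbours P z)))"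
  proof (intro sum.cong refl)
    fix z assume "z \<in> Z'"
    hence "neighbours P z \<noteq> {}" using nb by (auto simp: Z'_def)
    thus "1 = (\<Sum>p\<in>neighbours P z. 1 / real (card (neighbours P z)))" by simp
  qed
  also have "\<dots> = (\<Sum>z\<in>Z'. \<Sum>p | p \<in> P' \<and> p \<in> neighbours P z. 1 / real (card (neighbours P z)))"
    using nbP by (intro sum.cong refl) simp
  \<comment> \<open>Double counting: the charge is now collected at its receivers.\<close>
  also have "\<dots> = (\<Sum>p\<in>P'. \<Sum>z | z \<in> Z' \<and> p \<in> neighbours P z. 1 / real (card (neighbours P z)))"
    using fin by (rule sum.swap_restrict)
  also have "\<dots> \<le> (\<Sum>p\<in>P'. load Z P p)"
    unfolding load_def
  proof (intro sum_mono sum_mono2)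
    fix p assume "p \<in> P'"
    thus "{z \<in> Z'. p \<in> neighbours P z} \<subseteq> neighbours Z p"
      by (auto simp: Z'_def P'_def neighbours_def)
  qed auto
  finally have 1: "real (card Z') \<le> (\<Sum>p\<in>P'. load Z P p)" .
  have "Z \<inter> cball 0 t \<subseteq> Z' \<union> (Z \<inter> cball 0 R)"
    by (auto simp: Z'_def)
  hence "card (Z \<inter> cball 0 t) \<le> card (Z' \<union> (Z \<inter> cball 0 R))"
    using fin finZ by (intro card_mono) auto
  also have "\<dots> \<le> card Z' + card (Z \<inter> cball 0 R)" by (rule card_Un_le)
  finally show ?thesis using 1 by (simp add: P'_def)
qed

text \<open>\<open>k\<close> is the least pole order that takes part in the distribution: 2 for
  \<open>c\<close> not identically zero, 1 for \<open>c = 0\<close>. A point of the finite set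
  \<open>F\<close> receives at most 2, so \<open>F\<close> disappears in the constant, as do the
  points of \<open>Z\<close> near the origin.\<close>

lemma card_le_sum_multiplicity:
  fixes \<mu> :: "complex \<Rightarrow> nat"
  assumes finZ: "\<And>r. finite (Z \<inter> cball 0 r)" and finP: "\<And>r. finite ({p. \<mu> p > 0} \<inter> cball 0 r)"
    and k: "k > 0" and P: "P = {p. \<mu> p \<ge> k}"
    and nb: "\<And>z. z \<in> Z \<Longrightarrow> R \<le> norm z \<Longrightarrow> neighbours P z \<noteq> {}"
    and F: "finite F" and ld: "\<And>p. p \<in> P \<Longrightarrow> p \<notin> F \<Longrightarrow> load Z P p \<le> \<alpha> * real (\<mu> p)"
    and \<alpha>: "\<alpha> \<ge> 0"
  shows "\<exists>K. \<forall>t. real (card (Z \<inter> cball 0 t)) \<le> \<alpha> * real (\<Sum>p | \<mu> p > 0 \<and> norm p \<le> t + 1. \<mu> p) + K"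
proof (intro exI allI)
  fix t :: real
  have sub: "P \<inter> cball 0 r \<subseteq> {p. \<mu> p > 0} \<inter> cball 0 r" for r using P k by auto
  have finP': "finite (P \<inter> cball 0 r)" for r using finite_subset[OF sub finP] .
  have "real (card (Z \<inter> cball 0 t)) \<le> (\<Sum>p\<in>P \<inter> cball 0 (t + 1). load Z P p) + real (card (Z \<inter> cball 0 R))"
    by (rule card_le_sum_load[OF finZ finP' nb])
  also have "(\<Sum>p\<in>P \<inter> cball 0 (t + 1). load Z P p)
      \<le> (\<Sum>p\<in>P \<inter> cball 0 (t + 1). \<alpha> * real (\<mu> p) + (if p \<in> F then 2 else 0))"
  proof (intro sum_mono)
    fix p assume p: "p \<in> P \<inter> cball 0 (t + 1)"
    show "load Z P p \<le> \<alpha> * real (\<mu> p) + (if p \<in> F then 2 else 0)"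
    proof (cases "p \<in> F")
      case True
      have "load Z P p \<le> 2"
        using load_le_card[of Z P p] card_neighbours_le_2[of Z p] by linarith
      moreover have "0 \<le> \<alpha> * real (\<mu> p)" using \<alpha> by simp
      ultimately show ?thesis using True by simp
    qed (use p ld in auto)
  qed
  also have "\<dots> = \<alpha> * (\<Sum>p\<in>P \<inter> cball 0 (t + 1). real (\<mu> p)) + (\<Sum>p\<in>P \<inter> cball 0 (t + 1). if p \<in> F then 2 else 0)"
    by (simp add: sum.distrib sum_distrib_left)
  also have "(\<Sum>p\<in>P \<inter> cball 0 (t + 1). if p \<in> F then 2 else 0) \<le> 2 * real (card F)"
  proof -
    have "(\<Sum>p\<in>P \<inter> cball 0 (t + 1). if p \<in> F then 2 else (0::real)) = (\<Sum>p\<in>P \<inter> cball 0 (t + 1) \<inter> F. 2)"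
      using finP' by (subst sum.inter_restrict) auto
    also have "\<dots> \<le> 2 * real (card F)"
      using card_mono[OF F, of "P \<inter> cball 0 (t + 1) \<inter> F"] by simp
    finally show ?thesis .
  qed
  also have "(\<Sum>p\<in>P \<inter> cball 0 (t + 1). real (\<mu> p)) \<le> (\<Sum>p | \<mu> p > 0 \<and> norm p \<le> t + 1. real (\<mu> p))"
    using finP[of "t + 1"] P k by (intro sum_mono2) (auto simp: Int_def)
  also have "\<dots> = real (\<Sum>p | \<mu> p > 0 \<and> norm p \<le> t + 1. \<mu> p)" by simp
  finally show "real (card (Z \<inter> cball 0 t)) \<le> \<alpha> * real (\<Sum>p | \<mu> p > 0 \<and> norm p \<le> t + 1. \<mu> p)
      + (2 * real (card F) + real (card (Z \<inter> cball 0 R)))"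
    using \<alpha> by (simp add: mult_left_mono)
qed

text \<open>The case of \<open>c\<close> not identically zero. With receivers restricted to orders
  at least 2, \<open>sep\<close> applies to all of them far out, so each load is at most 1, that is
  half the order; the weaker 3/4 is recorded to match the other case.\<close>

lemma card_le_half_sum_multiplicity:
  fixes \<mu> :: "complex \<Rightarrow> nat"
  assumes finZ: "\<And>r. finite (Z \<inter> cball 0 r)" and finP: "\<And>r. finite ({p. \<mu> p > 0} \<inter> cball 0 r)"
    and nb: "\<And>z. z \<in> Z \<Longrightarrow> R \<le> norm z \<Longrightarrow> \<mu> (z - 1) \<ge> 2 \<or> \<mu> (z + 1) \<ge> 2"
    and sep: "\<And>p. R \<le> norm p \<Longrightarrow> \<mu> p \<ge> 2 \<Longrightarrow> p - 1 \<notin> Z \<or> p + 1 \<notin> Z"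
  shows "\<exists>K. \<forall>t. real (card (Z \<inter> cball 0 t)) \<le> 3 / 4 * real (\<Sum>p | \<mu> p > 0 \<and> norm p \<le> t + 1. \<mu> p) + K"
proof (rule card_le_sum_multiplicity[OF finZ finP, where k = 2 and P = "{p. \<mu> p \<ge> 2}" and R = R
      and F = "{p. \<mu> p > 0} \<inter> cball 0 R"])
  fix p assume p: "p \<in> {p. \<mu> p \<ge> 2}" "p \<notin> {p. \<mu> p > 0} \<inter> cball 0 R"
  hence "load Z {p. \<mu> p \<ge> 2} p \<le> 1"
    using load_le_card[of Z "{p. \<mu> p \<ge> 2}" p] card_neighbours_le_1[of p Z] sep[of p] by auto
  also have "1 \<le> 3 / 4 * real (\<mu> p)" using p by simp
  finally show "load Z {p. \<mu> p \<ge> 2} p \<le> 3 / 4 * real (\<mu> p)" .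
qed (use nb finP in \<open>auto simp: neighbours_def\<close>)

text \<open>The case \<open>c = 0\<close>. Simple poles take part as well, so that the exceptional
  configuration has no pole at all at \<open>p - 2\<close> and \<open>p + 2\<close>; a simple pole
  there would already disturb the second coefficient relation.\<close>

lemma card_le_three_quarters_sum_multiplicity:
  fixes \<mu> :: "complex \<Rightarrow> nat"
  assumes finZ: "\<And>r. finite (Z \<inter> cball 0 r)" and finP: "\<And>r. finite ({p. \<mu> p > 0} \<inter> cball 0 r)"
    and nb: "\<And>z. z \<in> Z \<Longrightarrow> R \<le> norm z \<Longrightarrow> \<mu> (z - 1) \<ge> 2 \<or> \<mu> (z + 1) \<ge> 2"
    and sep: "\<And>p. R \<le> norm p \<Longrightarrow> \<mu> p = 1 \<Longrightarrow> p - 1 \<notin> Z \<or> p + 1 \<notin> Z"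
    and good: "finite {p. \<mu> p = 2 \<and> p - 1 \<in> Z \<and> p + 1 \<in> Z \<and> \<mu> (p - 2) = 0 \<and> \<mu> (p + 2) = 0}"
      (is "finite ?G")
  shows "\<exists>K. \<forall>t. real (card (Z \<inter> cball 0 t)) \<le> 3 / 4 * real (\<Sum>p | \<mu> p > 0 \<and> norm p \<le> t + 1. \<mu> p) + K"
proof (rule card_le_sum_multiplicity[OF finZ finP, where k = 1 and P = "{p. \<mu> p \<ge> 1}" and R = R
      and F = "{p. \<mu> p > 0} \<inter> cball 0 (R + 1) \<union> ?G"])
  let ?P = "{p. \<mu> p \<ge> 1}"
  fix p assume p: "p \<in> ?P" "p \<notin> {p. \<mu> p > 0} \<inter> cball 0 (R + 1) \<union> ?G"
  hence Rp: "R + 1 < norm p" by auto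
  have R1: "R \<le> norm (p - 1)" "R \<le> norm (p + 1)"
    using Rp norm_triangle_ineq2[of p 1] norm_triangle_ineq2[of p "-1"] by auto
  consider "\<mu> p = 1" | "\<mu> p = 2" | "\<mu> p \<ge> 3" using p by fastforce
  thus "load Z ?P p \<le> 3 / 4 * real (\<mu> p)"
  proof cases
    case 1
    \<comment> \<open>\<open>nb\<close> supplies the zero with a pole of order at least 2, which
      must lie on the side away from the simple pole; so the zero passes on only 1/2.\<close>
    have half: "card (neighbours ?P z) = 2" if "z \<in> neighbours Z p" for z
    proof -
      have z: "z = p - 1 \<or> z = p + 1" "z \<in> Z" using that by (auto simp: neighbours_def)
      have "R \<le> norm z" using z R1 by auto
      hence "\<mu> (z - 1) \<ge> 2 \<or> \<mu> (z + 1) \<ge> 2" using nb z by blast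
      hence "z - 1 \<in> ?P \<and> z + 1 \<in> ?P" using z 1 by auto
      thus ?thesis by (intro card_neighbours_eq_2) auto
    qed
    have "load Z ?P p = (\<Sum>z\<in>neighbours Z p. 1 / 2)"
      unfolding load_def by (intro sum.cong refl) (simp only: half of_nat_numeral)
    also have "\<dots> \<le> 1 / 2"
      using card_neighbours_le_1[of p Z] sep[of p] 1 Rp by (auto split: if_splits)
    finally show ?thesis using 1 by simp
  next
    case 2
    show ?thesis
    proof (cases "p - 1 \<in> Z \<and> p + 1 \<in> Z")
      case True
      \<comment> \<open>Off \<open>?G\<close> at least one of the two zeros is shared, and 1 + 1/2 =
        3/4 * 2 is the extremal case.\<close>
      hence "\<mu> (p - 2) \<ge> 1 \<or> \<mu> (p + 2) \<ge> 1" using p 2 by force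
      hence "card (neighbours ?P (p - 1)) = 2 \<or> card (neighbours ?P (p + 1)) = 2"
        using card_neighbours_eq_2[of "p - 1" ?P] card_neighbours_eq_2[of "p + 1" ?P] 2
        by (auto simp: add.commute)
      thus ?thesis
        using load_both[of p Z ?P] True inverse_card_neighbours_le_1[of ?P "p - 1"]
          inverse_card_neighbours_le_1[of ?P "p + 1"] 2 by auto
    next
      case False
      thus ?thesis
        using load_le_card[of Z ?P p] card_neighbours_le_1[of p Z] 2 by auto
    qed
  next
    case 3
    thus ?thesis using load_le_card[of Z ?P p] card_neighbours_le_2[of Z p] by linarith
  qed
next
  show "neighbours {p. \<mu> p \<ge> 1} z \<noteq> {}" if "z \<in> Z" "R \<le> norm z" for z
    using nb[OF that] by (auto simp: neighbours_def)
qed (use finP good in auto)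

section \<open>Meromorphic functions with finitely many zeros and poles\<close>

lemma zorder_linear: "zorder (\<lambda>w. w - s) z = (if z = s then 1 else 0)" for s z :: complex
proof (cases "z = s")
  case True
  have "zorder (\<lambda>w. w - s) s = 1"
    by (rule zorder_eqI[of UNIV _ "\<lambda>_. 1"]) auto
  thus ?thesis using True by simp
next
  case False
  thus ?thesis by (auto intro!: zorder_eq_0I analytic_intros)
qed

lemma zorder_prod_linear:
  fixes n :: "complex \<Rightarrow> nat"
  assumes "finite A"
  shows "zorder (\<lambda>w. \<Prod>s\<in>A. (w - s) ^ n s) z = (if z \<in> A then int (n z) else 0)"
proof -
  have nz: "\<forall>\<^sub>F w in at z. w - s \<noteq> 0" for s
    using eventually_neq_at_within[of s z UNIV] by simp
  have ev: "\<forall>\<^sub>F w in at z. (\<Prod>s\<in>A. (w - s) ^ n s) \<noteq> 0"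
  proof -
    have "\<forall>\<^sub>F w in at z. \<forall>s\<in>A. w - s \<noteq> 0"
      using assms nz by (intro eventually_ball_finite) auto
    thus ?thesis by eventually_elim (use assms in auto)
  qed
  have "zorder (\<lambda>w. \<Prod>s\<in>A. (w - s) ^ n s) z = (\<Sum>s\<in>A. zorder (\<lambda>w. (w - s) ^ n s) z)"
    by (rule zorder_prod) (use ev in \<open>auto intro!: meromorphic_intros\<close>)
  also have "\<dots> = (\<Sum>s\<in>A. if z = s then int (n s) else 0)"
  proof (intro sum.cong refl)
    fix s
    have "zorder (\<lambda>w. (w - s) ^ n s) z = int (n s) * zorder (\<lambda>w. w - s) z"
      using nz[of s] by (intro zorder_power) (auto intro!: meromorphic_intros eventually_frequently)
    thus "zorder (\<lambda>w. (w - s) ^ n s) z = (if z = s then int (n s) else 0)"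
      by (simp add: zorder_linear)
  qed
  also have "\<dots> = (if z \<in> A then int (n z) else 0)"
    using assms by (simp add: sum.delta')
  finally show ?thesis .
qed

text \<open>Dividing by the polynomial with the same zeros and multiplicities leaves a zero-free
  entire function, which has a holomorphic logarithm because the plane is contractible.\<close>

lemma entire_finite_zeros_poly_exp:
  assumes f: "f holomorphic_on UNIV" and fin: "finite {z. f z = 0}"
  obtains p h where "p \<noteq> 0" "h holomorphic_on UNIV" "\<And>z. f z = poly p z * exp (h z)"
proof -
  define A where "A = {z. f z = 0}"
  define n where "n = (\<lambda>z. nat (zorder f z))"
  define g where "g = (\<lambda>w. \<Prod>s\<in>A. (w - s) ^ n s)"
  have nzf: "\<exists>\<^sub>F w in at z. f w \<noteq> 0" for z
  proof -
    have "\<forall>\<^sub>F w in at z. w \<notin> A"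
      using fin islimpt_finite[of A z] by (simp add: A_def islimpt_conv_frequently_at not_frequently)
    hence "\<forall>\<^sub>F w in at z. f w \<noteq> 0" by (simp add: A_def)
    thus ?thesis by (intro eventually_frequently) auto
  qed
  have an: "f analytic_on {z}" for z
    using f analytic_on_holomorphic by blast
  have pos: "zorder f z > 0 \<longleftrightarrow> f z = 0" for z
    by (rule zorder_pos_iff'[OF an nzf])
  have zero: "zorder f z = 0 \<longleftrightarrow> f z \<noteq> 0" for z
    by (rule zorder_eq_0_iff[OF an nzf])
  have zg: "zorder g z = zorder f z" for z
    using zorder_prod_linear[of A n z] fin pos[of z] zero[of z]
    by (auto simp: g_def A_def n_def)
  have g0: "g z = 0 \<longleftrightarrow> f z = 0" for z
  proof -
    have "g z = 0 \<longleftrightarrow> (\<exists>s\<in>A. z = s \<and> n s > 0)"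
      using fin by (auto simp: g_def A_def)
    thus ?thesis using pos by (auto simp: A_def n_def)
  qed
  have holg: "g holomorphic_on UNIV"
    unfolding g_def by (intro holomorphic_intros)
  obtain k where k: "k holomorphic_on UNIV" "\<And>z. k z \<noteq> 0" "\<And>z. f z = k z * g z"
  proof (rule holomorphic_zorder_factorization[OF f open_UNIV connected_UNIV holg])
    show "g z = 0 \<longleftrightarrow> f z = 0" "zorder g z = zorder f z" for z by (fact g0, fact zg)
  qed blast
  obtain h where h: "h holomorphic_on UNIV" "\<And>z. k z = exp (h z)"
    using contractible_imp_holomorphic_log[OF k(1) contractible_UNIV] k(2) by (metis UNIV_I)
  define p where "p = (\<Prod>s\<in>A. [:-s, 1:] ^ n s)"
  have "p \<noteq> 0" using fin by (simp add: p_def A_def)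
  moreover have "poly p z = g z" for z
    by (simp add: p_def g_def poly_prod)
  ultimately show ?thesis
    using that[of p h] k h by (simp add: mult.commute)
qed

section \<open>Taylor coefficients of entire functions as circle means\<close>

lemma circle_integral_cis_neg:
  fixes h :: "complex \<Rightarrow> complex" and r :: real
  assumes h: "h holomorphic_on UNIV" and r: "r > 0"
  shows "integral {0..2*pi} (\<lambda>t. h (of_real r * cis t) * cis (- real n * t))
           = 2 * pi * of_real r ^ n * (deriv ^^ n) h 0 / fact n"
proof -
  have "contour_integral (circlepath 0 r) (\<lambda>u. h u / (u - 0) ^ Suc n) = (2 * pi * \<i>) * (deriv ^^ n) h 0 / (fact n)"
    using h r by (intro Cauchy_contour_integral_circlepath holomorphic_on_imp_continuous_on)
      (auto intro: holomorphic_on_subset)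
  also have "contour_integral (circlepath 0 r) (\<lambda>u. h u / (u - 0) ^ Suc n)
     = integral {0..2*pi} (\<lambda>t. h (0 + of_real r * cis t) / (0 + of_real r * cis t - 0) ^ Suc n * of_real r * \<i> * cis t)"
    unfolding circlepath_def by (rule contour_integral_part_circlepath_eq) simp
  also have "\<dots> = integral {0..2*pi} (\<lambda>t. (\<i> / of_real r ^ n) * (h (of_real r * cis t) * cis (- real n * t)))"
  proof (intro integral_cong)
    fix t
    have "cis t ^ n = cis (real n * t)" by (rule Complex.DeMoivre)
    hence "cis (- real n * t) = 1 / cis t ^ n"
      by (simp add: divide_inverse)
    thus "h (0 + of_real r * cis t) / (0 + of_real r * cis t - 0) ^ Suc n * of_real r * \<i> * cis t
        = (\<i> / of_real r ^ n) * (h (of_real r * cis t) * cis (- real n * t))"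
      using r by (simp add: field_simps power_mult_distrib)
  qed
  also have "\<dots> = (\<i> / of_real r ^ n) * integral {0..2*pi} (\<lambda>t. h (of_real r * cis t) * cis (- real n * t))"
    by (rule integral_mult_right)
  finally show ?thesis using r by (simp add: field_simps)
qed

text \<open>These are the Fourier coefficients of \<open>h\<close> on the circle with negative
  index; they vanish by Cauchy's theorem, as \<open>h u * u ^ n\<close> is entire.\<close>

lemma circle_integral_cis_pos:
  fixes h :: "complex \<Rightarrow> complex" and r :: real
  assumes h: "h holomorphic_on UNIV" and r: "r > 0"
  shows "integral {0..2*pi} (\<lambda>t. h (of_real r * cis t) * cis (real (Suc n) * t)) = 0"
proof -
  have "((\<lambda>u. h u * u ^ n) has_contour_integral 0) (circlepath 0 r)"
    by (rule Cauchy_theorem_disc_simple[of _ 0 "r + 1"])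
       (use h r in \<open>auto intro!: holomorphic_intros intro: holomorphic_on_subset simp: dist_norm\<close>)
  hence "0 = contour_integral (circlepath 0 r) (\<lambda>u. h u * u ^ n)"
    by (simp add: contour_integral_unique)
  also have "\<dots> = integral {0..2*pi} (\<lambda>t. h (0 + of_real r * cis t) * (0 + of_real r * cis t) ^ n * of_real r * \<i> * cis t)"
    unfolding circlepath_def by (rule contour_integral_part_circlepath_eq) simp
  also have "\<dots> = integral {0..2*pi} (\<lambda>t. (\<i> * of_real r ^ Suc n) * (h (of_real r * cis t) * cis (real (Suc n) * t)))"
  proof (intro integral_cong)
    fix t
    have "cis (real (Suc n) * t) = cis t ^ Suc n"
      by (rule Complex.DeMoivre[symmetric])
    thus "h (0 + of_real r * cis t) * (0 + of_real r * cis t) ^ n * of_real r * \<i> * cis t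
      = (\<i> * of_real r ^ Suc n) * (h (of_real r * cis t) * cis (real (Suc n) * t))"
      by (simp add: power_mult_distrib)
  qed
  also have "\<dots> = (\<i> * of_real r ^ Suc n) * integral {0..2*pi} (\<lambda>t. h (of_real r * cis t) * cis (real (Suc n) * t))"
    by (rule integral_mult_right)
  finally show ?thesis using r by simp
qed

text \<open>The Taylor coefficients of an entire function are controlled by the mean of the positive part
  of its real part, since the mean of the real part itself is fixed.\<close>

lemma norm_higher_deriv_le_positive_part:
  fixes h :: "complex \<Rightarrow> complex" and r :: real
  assumes h: "h holomorphic_on UNIV" and r: "r > 0" and n: "n > 0"
  shows "pi * r ^ n * norm ((deriv ^^ n) h 0) / fact n
     \<le> 2 * integral {0..2*pi} (\<lambda>t. max 0 (Re (h (of_real r * cis t)))) - 2 * pi * Re (h 0)"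
proof -
  define H where "H = (\<lambda>t. h (of_real r * cis t))"
  have ch: "continuous_on A H" for A
    unfolding H_def using h
    by (intro continuous_on_compose2[OF holomorphic_on_imp_continuous_on[OF h]] continuous_intros) auto
  have ci: "(\<lambda>t. F t) integrable_on {0..2*pi}" if "continuous_on {0..2*pi} F" for F :: "real \<Rightarrow> complex"
    using that by (rule integrable_continuous_interval)
  have ciR: "(\<lambda>t. F t) integrable_on {0..2*pi}" if "continuous_on {0..2*pi} F" for F :: "real \<Rightarrow> real"
    using that by (rule integrable_continuous_interval)
  have i1: "integral {0..2*pi} (\<lambda>t. H t * cis (- real n * t)) = 2 * pi * of_real r ^ n * (deriv ^^ n) h 0 / fact n"
    unfolding H_def by (rule circle_integral_cis_neg[OF h r])
  obtain m where m: "n = Suc m" using n gr0_conv_Suc by blast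
  \<comment> \<open>Conjugating the vanishing coefficient of opposite index allows \<open>H\<close>
    to be replaced by \<open>H + cnj H\<close>, so that only the real part of \<open>h\<close>
    remains.\<close>
  have "integral {0..2*pi} (\<lambda>t. cnj (H t) * cis (- real n * t)) = cnj (integral {0..2*pi} (\<lambda>t. H t * cis (real n * t)))"
    unfolding Henstock_Kurzweil_Integration.integral_cnj by (simp add: cis_cnj)
  also have "integral {0..2*pi} (\<lambda>t. H t * cis (real n * t)) = 0"
    unfolding H_def m by (rule circle_integral_cis_pos[OF h r])
  finally have i2: "integral {0..2*pi} (\<lambda>t. cnj (H t) * cis (- real n * t)) = 0"
    by (simp only: complex_cnj_zero)
  have "integral {0..2*pi} (\<lambda>t. H t * cis (- real n * t))
      = integral {0..2*pi} (\<lambda>t. H t * cis (- real n * t)) + integral {0..2*pi} (\<lambda>t. cnj (H t) * cis (- real n * t))"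
    by (simp only: i2 add_0_right)
  also have "\<dots> = integral {0..2*pi} (\<lambda>t. H t * cis (- real n * t) + cnj (H t) * cis (- real n * t))"
    by (intro integral_add[symmetric] ci continuous_intros ch)
  also have "\<dots> = integral {0..2*pi} (\<lambda>t. of_real (2 * Re (H t)) * cis (- real n * t))"
    by (simp add: complex_add_cnj flip: distrib_right)
  finally have "norm (2 * pi * of_real r ^ n * (deriv ^^ n) h 0 / fact n)
      = norm (integral {0..2*pi} (\<lambda>t. of_real (2 * Re (H t)) * cis (- real n * t)))"
    using i1 by simp
  also have "\<dots> \<le> integral {0..2*pi} (\<lambda>t. 2 * \<bar>Re (H t)\<bar>)"
    by (intro integral_norm_bound_integral ci ciR continuous_intros ch) (simp add: norm_mult)
  \<comment> \<open>The identity \<open>2 * abs x = 4 * max 0 x - 2 * x\<close> trades the absolute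
    value for the positive part, the quantity that \<open>log_plus\<close> controls.\<close>
  also have "\<dots> = integral {0..2*pi} (\<lambda>t. 4 * max 0 (Re (H t)) - 2 * Re (H t))"
    by (intro integral_cong) auto
  also have "\<dots> = 4 * integral {0..2*pi} (\<lambda>t. max 0 (Re (H t))) - 2 * integral {0..2*pi} (\<lambda>t. Re (H t))"
    by (subst integral_diff) (auto intro!: ciR continuous_intros ch)
  also have "integral {0..2*pi} (\<lambda>t. Re (H t)) = Re (integral {0..2*pi} H)"
    using integral_linear[OF ci[OF ch] bounded_linear_Re] by (simp add: o_def)
  also have "integral {0..2*pi} H = 2 * pi * h 0"
    using circle_integral_cis_neg[OF h r, of 0] by (simp add: H_def)
  finally show ?thesis
    using r by (simp add: H_def norm_mult norm_divide norm_power)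
qed


text \<open>For \<open>n > 0\<close> a nonzero coefficient would force
  \<open>a * r \<le> 2 * C * ln r + D\<close> at arbitrarily large r. The hypothesis is stated for
  some large radii only, because bounds will hold merely off an exceptional set.\<close>

lemma entire_constant_of_ln_growth:
  fixes h :: "complex \<Rightarrow> complex" and C :: real
  assumes h: "h holomorphic_on UNIV"
    and C: "\<And>R. \<exists>r\<ge>R. integral {0..2*pi} (\<lambda>t. max 0 (Re (h (of_real r * cis t)))) \<le> C * ln r"
  shows "h z = h 0"
proof (rule holomorphic_fun_eq_const_on_connected[OF h open_UNIV connected_UNIV])
  fix n :: nat assume n: "0 < n"
  show "(deriv ^^ n) h 0 = 0"
  proof (rule ccontr)
    assume nz: "(deriv ^^ n) h 0 \<noteq> 0"
    define a where "a = pi * norm ((deriv ^^ n) h 0) / fact n"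
    define D where "D = - 2 * pi * Re (h 0)"
    have a: "a > 0" using nz by (simp add: a_def)
    have "((\<lambda>r. 2 * C * (ln r / r) + D * inverse r) \<longlongrightarrow> 2 * C * 0 + D * 0) at_top"
      by (intro tendsto_intros ln_x_over_x_tendsto_0 tendsto_inverse_0_at_top filterlim_ident)
    hence "\<forall>\<^sub>F r in at_top. 2 * C * (ln r / r) + D * inverse r < a"
      using a by (intro order_tendstoD(2)) auto
    moreover have "\<forall>\<^sub>F r::real in at_top. r > 1" by (rule eventually_gt_at_top)
    ultimately have "\<forall>\<^sub>F r in at_top. r > 1 \<and> 2 * C * (ln r / r) + D * inverse r < a"
      by eventually_elim auto
    then obtain R where R: "\<And>r. r \<ge> R \<Longrightarrow> r > 1 \<and> 2 * C * (ln r / r) + D * inverse r < a"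
      by (auto simp: eventually_at_top_linorder)
    obtain r where r: "r \<ge> R" "integral {0..2*pi} (\<lambda>t. max 0 (Re (h (of_real r * cis t)))) \<le> C * ln r"
      using C by blast
    have r1: "r > 1" "2 * C * (ln r / r) + D * inverse r < a" using R r by auto
    have "a * r ^ 1 \<le> a * r ^ n"
      using a n r1 by (intro mult_left_mono power_increasing) auto
    also have "\<dots> = pi * r ^ n * norm ((deriv ^^ n) h 0) / fact n" by (simp add: a_def)
    also have "\<dots> \<le> 2 * (C * ln r) + D"
      using norm_higher_deriv_le_positive_part[OF h _ n, of r] r r1 by (simp add: D_def)
    finally have "a * r \<le> 2 * C * ln r + D" by simp
    moreover have "(2 * C * (ln r / r) + D * inverse r) * r < a * r"
      using r1 by (intro mult_strict_right_mono) auto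
    ultimately show False using r1 by (simp add: field_simps)
  qed
qed auto

section \<open>Bounds for polynomials and the proximity function\<close>

lemma poly_norm_upper_bound:
  fixes p :: "complex poly"
  obtains M where "M \<ge> 1" "\<And>z. norm z \<ge> 1 \<Longrightarrow> norm (poly p z) \<le> M * norm z ^ degree p"
proof
  let ?M = "1 + (\<Sum>i\<le>degree p. norm (coeff p i))"
  show "?M \<ge> 1" by (simp add: sum_nonneg)
  fix z :: complex assume z: "norm z \<ge> 1"
  have "norm (poly p z) \<le> (\<Sum>i\<le>degree p. norm (coeff p i * z ^ i))"
    unfolding poly_altdef by (rule norm_sum)
  also have "\<dots> \<le> (\<Sum>i\<le>degree p. norm (coeff p i) * norm z ^ degree p)"
    using z by (intro sum_mono) (auto simp: norm_mult norm_power intro!: mult_left_mono power_increasing)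
  also have "\<dots> \<le> ?M * norm z ^ degree p"
    by (simp add: distrib_right flip: sum_distrib_right)
  finally show "norm (poly p z) \<le> ?M * norm z ^ degree p" .
qed

lemma poly_norm_lower_bound:
  fixes p :: "complex poly"
  assumes "p \<noteq> 0"
  obtains R c where "c > 0" "\<And>z. norm z \<ge> R \<Longrightarrow> c \<le> norm (poly p z)"
proof (cases "degree p = 0")
  case True
  then obtain a where "p = [:a:]" by (auto elim: degree_eq_zeroE)
  with assms that[of "norm a" 0] show ?thesis by auto
next
  case False
  hence "filterlim (poly p) at_infinity at_infinity"
    by (intro filterlim_poly_at_infinity) auto
  hence "\<forall>\<^sub>F z in at_infinity. norm (poly p z) \<ge> 1"
    by (auto simp: filterlim_at_infinity[of 0])
  with that[of 1] show ?thesis by (auto simp: eventually_at_infinity)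
qed

lemma log_plus_mult_le: "0 \<le> x \<Longrightarrow> 0 \<le> y \<Longrightarrow> log_plus (x * y) \<le> log_plus x + log_plus y"
proof -
  assume xy: "0 \<le> x" "0 \<le> y"
  have "max 1 (x * y) \<le> max 1 x * max 1 y"
    using xy mult_mono[of x "max 1 x" y "max 1 y"] mult_mono[of 1 "max 1 x" 1 "max 1 y"] by auto
  hence "ln (max 1 (x * y)) \<le> ln (max 1 x * max 1 y)" by simp
  also have "\<dots> = ln (max 1 x) + ln (max 1 y)" by (simp add: ln_mult)
  finally show ?thesis by (simp add: log_plus_def)
qed

lemma log_plus_exp: "log_plus (exp x) = max 0 x"
  by (simp add: log_plus_def max_def)

lemma log_plus_nonneg: "0 \<le> log_plus x"
  by (simp add: log_plus_def)

lemma log_plus_mono: "x \<le> y \<Longrightarrow> log_plus x \<le> log_plus y"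
  by (simp add: log_plus_def)

lemma proximity_nonneg: "0 \<le> proximity f r"
proof -
  have "0 \<le> integral {0..2*pi} (\<lambda>t. log_plus (norm (f (of_real r * cis t))))"
    by (cases "(\<lambda>t. log_plus (norm (f (of_real r * cis t)))) integrable_on {0..2*pi}")
       (auto intro: integral_nonneg simp: log_plus_nonneg not_integrable_integral)
  thus ?thesis by (simp add: proximity_def)
qed

lemma inj_on_cis: "inj_on cis {0..<2*pi}"
proof (rule inj_onI)
  fix x y assume xy: "x \<in> {0..<2*pi}" "y \<in> {0..<2*pi}" "cis x = cis y"
  hence "sin y = sin x \<and> cos y = cos x" by (simp add: complex_eq_iff)
  then obtain n :: int where n: "y = x + 2 * pi * n" by (auto simp: sin_cos_eq_iff)
  have "\<bar>2 * pi * n\<bar> < 2 * pi" using xy n by auto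
  hence "\<bar>real_of_int n\<bar> < 1" by (simp add: abs_mult)
  hence "n = 0" by linarith
  thus "x = y" using n by simp
qed

lemma finite_circle_preimage:
  assumes "finite A" and "r > 0"
  shows "finite {t \<in> {0..2*pi}. of_real r * cis t \<in> A}"
proof -
  have "inj_on (\<lambda>t. of_real r * cis t) {0..<2*pi}"
    using inj_on_cis assms by (auto simp: inj_on_def)
  hence "finite ((\<lambda>t. of_real r * cis t) -` A \<inter> {0..<2*pi})"
    using assms by (intro finite_vimage_IntI)
  moreover have "{t \<in> {0..2*pi}. of_real r * cis t \<in> A}
      \<subseteq> insert (2 * pi) ((\<lambda>t. of_real r * cis t) -` A \<inter> {0..<2*pi})" by auto
  ultimately show ?thesis by (meson finite_insert finite_subset)
qed

text \<open>The two functions differ at finitely many points of a circle, a null set of angles. This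
  allows \<open>w\<close> to be replaced by a representative without removable
  singularities.\<close>

lemma proximity_cong:
  assumes "\<forall>\<^sub>\<approx>z. f z = g z" and "r > 0"
  shows "proximity f r = proximity g r"
proof -
  have "{z. f z \<noteq> g z} sparse_in UNIV" using assms by (simp add: eventually_cosparse)
  hence fin: "finite ({z. f z \<noteq> g z} \<inter> cball 0 r)"
    using sparse_in_compact_finite[of _ "cball 0 r"] sparse_in_subset
    by (metis Int_commute compact_cball subset_UNIV)
  have "integral {0..2*pi} (\<lambda>t. log_plus (norm (f (of_real r * cis t)))) =
        integral {0..2*pi} (\<lambda>t. log_plus (norm (g (of_real r * cis t))))"
    by (rule integral_spike[OF negligible_finite[OF finite_circle_preimage[OF fin assms(2)]]])
       (use assms(2) in \<open>auto simp: norm_mult\<close>)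
  thus ?thesis by (simp add: proximity_def)
qed


section \<open>Laurent expansions of meromorphic functions\<close>

lemma meromorphic_laurent:
  assumes "w meromorphic_on UNIV"
  shows "(\<lambda>u. w (z + u)) has_laurent_expansion laurent_expansion w z"
  using assms by (intro not_essential_has_laurent_expansion meromorphic_on_isolated_singularity
      meromorphic_on_not_essential) (auto intro: meromorphic_on_subset)

lemma meromorphic_is_pole_iff:
  assumes "w meromorphic_on UNIV"
  shows "is_pole w z \<longleftrightarrow> fls_subdegree (laurent_expansion w z) < 0"
  by (rule is_pole_fls_subdegree_iff[OF meromorphic_laurent[OF assms]])

lemma meromorphic_is_pole_inverse_iff:
  assumes "w meromorphic_on UNIV"
  shows "is_pole (\<lambda>z. 1 / w z) z \<longleftrightarrow> fls_subdegree (laurent_expansion w z) > 0"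
proof -
  have "(\<lambda>u. 1 / w (z + u)) has_laurent_expansion 1 / laurent_expansion w z"
    by (intro laurent_expansion_intros meromorphic_laurent assms)
  from is_pole_fls_subdegree_iff[of "\<lambda>z. 1 / w z", OF this] show ?thesis
    by (simp add: divide_inverse)
qed

lemma meromorphic_laurent_nonzero:
  assumes w: "w meromorphic_on UNIV" and nz: "\<not> (\<forall>\<^sub>\<approx>z. w z = 0)"
  shows "laurent_expansion w z \<noteq> 0"
proof -
  have "\<forall>\<^sub>\<approx>z. w z \<noteq> 0"
    using meromorphic_imp_constant_or_avoid[OF w open_UNIV connected_UNIV, of 0] nz by blast
  hence "\<forall>\<^sub>F u in at z. w u \<noteq> 0"
    by (simp add: eventually_cosparse_open_eq)
  thus ?thesis
    using has_laurent_expansion_eventually_nonzero_iff[OF meromorphic_laurent[OF w]] by blast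
qed

text \<open>Weierstrass factorization reduces \<open>w\<close> to \<open>p1 / p2 * exp H\<close>
  with polynomials \<open>p1\<close>, \<open>p2\<close>. The positive part of \<open>Re H\<close>
  equals \<open>log_plus (norm (exp H))\<close>, which exceeds \<open>log_plus (norm w)\<close> by
  at most O(log r) since \<open>p2 / p1\<close> grows at most polynomially; so \<open>H\<close> is
  constant.\<close>

lemma rational_of_proximity_ln_growth:
  fixes w :: "complex \<Rightarrow> complex" and C :: real
  assumes w: "w meromorphic_on UNIV" and nz: "\<not> (\<forall>\<^sub>\<approx>z. w z = 0)"
    and poles: "finite {z. is_pole w z}" and zeros: "finite {z. is_pole (\<lambda>z. 1 / w z) z}"
    and C: "\<And>R. \<exists>r\<ge>R. proximity w r \<le> C * ln r"
  shows "rational_function w"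
proof -
  define g where "g = remove_sings w"
  have g: "g nicely_meromorphic_on UNIV"
    unfolding g_def by (rule remove_sings_nicely_meromorphic[OF w])
  have wg: "\<forall>\<^sub>\<approx>z. w z = g z"
    using eventually_remove_sings_eq[OF w] by eventually_elim (simp add: g_def)
  have gp: "is_pole g z \<longleftrightarrow> is_pole w z" for z
    using w by (intro is_pole_cong eventually_cosparse_imp_eventually_at[of _ UNIV] eventually_mono[OF wg])
       auto
  obtain k f1 f2 where k: "k holomorphic_on UNIV" "f1 holomorphic_on UNIV" "f2 holomorphic_on UNIV"
    "\<forall>z. f1 z = 0 \<longleftrightarrow> \<not> is_pole g z \<and> g z = 0" "\<forall>z. f2 z = 0 \<longleftrightarrow> is_pole g z"
    "\<forall>z. k z \<noteq> 0" "\<forall>z. g z = k z * f1 z / f2 z"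
    by (rule weierstrass_factorization_meromorphic_UNIV[OF g])
  have f2fin: "finite {z. f2 z = 0}" using poles k(5) gp by simp
  have f1fin: "finite {z. f1 z = 0}"
  proof (rule finite_subset[OF _ zeros], clarify)
    fix z assume "f1 z = 0"
    hence gz: "\<not> is_pole g z" "g z = 0" using k(4) by auto
    have "\<forall>\<^sub>\<approx>z. w z \<noteq> 0"
      using meromorphic_imp_constant_or_avoid[OF w open_UNIV connected_UNIV, of 0] nz by blast
    hence "\<forall>\<^sub>\<approx>z. g z \<noteq> 0" using wg by eventually_elim auto
    hence "\<forall>\<^sub>F u in at z. g u \<noteq> 0" by (simp add: eventually_cosparse_open_eq)
    hence "isolated_zero g z" using zero_or_pole[OF g _ gz(2)] gz(1) by blast
    moreover have "w meromorphic_on {z}" using w by (rule meromorphic_on_subset) auto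
    ultimately have "isolated_zero w z"
      by (simp add: g_def meromorphic_at_iff)
    thus "is_pole (\<lambda>z. 1 / w z) z"
      using isolated_zero_fls_subdegree_iff[OF meromorphic_laurent[OF w]]
        meromorphic_is_pole_inverse_iff[OF w] by blast
  qed
  obtain p1 h1 where p1: "p1 \<noteq> 0" "h1 holomorphic_on UNIV" "\<And>z. f1 z = poly p1 z * exp (h1 z)"
    using entire_finite_zeros_poly_exp[OF k(2) f1fin] by blast
  obtain p2 h2 where p2: "p2 \<noteq> 0" "h2 holomorphic_on UNIV" "\<And>z. f2 z = poly p2 z * exp (h2 z)"
    using entire_finite_zeros_poly_exp[OF k(3) f2fin] by blast
  obtain h3 where h3: "h3 holomorphic_on UNIV" "\<And>z. k z = exp (h3 z)"
    using contractible_imp_holomorphic_log[OF k(1) contractible_UNIV] k(6) by (metis UNIV_I)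
  define H where "H = (\<lambda>z. h3 z + h1 z - h2 z)"
  have H: "H holomorphic_on UNIV" unfolding H_def using h3 p1 p2 by (intro holomorphic_intros)
  have gH: "g z = poly p1 z / poly p2 z * exp (H z)" for z
    using k(7) p1(3)[of z] p2(3)[of z] h3(2)[of z] by (simp add: H_def exp_add exp_diff)
  obtain M where M: "M \<ge> 1" "\<And>z. norm z \<ge> 1 \<Longrightarrow> norm (poly p2 z) \<le> M * norm z ^ degree p2"
    using poly_norm_upper_bound by blast
  obtain R1 c1 where c1: "c1 > 0" "\<And>z. norm z \<ge> R1 \<Longrightarrow> c1 \<le> norm (poly p1 z)"
    using poly_norm_lower_bound[OF p1(1)] by blast
  obtain R2 c2 where c2: "c2 > 0" "\<And>z. norm z \<ge> R2 \<Longrightarrow> c2 \<le> norm (poly p2 z)"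
    using poly_norm_lower_bound[OF p2(1)] by blast
  define B where "B = max 1 (M / c1)"
  define d where "d = degree p2"
  \<comment> \<open>Beyond \<open>R1\<close> and \<open>R2\<close> the circles avoid all roots,
    which keeps the integrand continuous; \<open>exp 1\<close> ensures \<open>ln r \<ge> 1\<close>,
    so constants may be multiplied by \<open>ln r\<close>.\<close>
  define R0 where "R0 = Max {R1, R2, exp 1}"
  have main: "integral {0..2*pi} (\<lambda>t. max 0 (Re (H (of_real r * cis t))))
      \<le> 2 * pi * (C + (ln B + real d)) * ln r"
    if r: "r \<ge> R0" and pr: "proximity w r \<le> C * ln r" for r
  proof -
    have r': "r \<ge> R1" "r \<ge> R2" "r \<ge> exp 1" using r by (auto simp: R0_def)
    have rp: "r > 0" "r \<ge> 1" using r'(3) exp_gt_one[of 1] by (simp, linarith)+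
    have lr: "ln r \<ge> 1" using r'(3) rp by (subst ln_ge_iff) auto
    define L where "L = (\<lambda>t. log_plus (norm (g (of_real r * cis t))))"
    have nr: "norm (of_real r * cis t) = r" for t using rp by (simp add: norm_mult)
    have nz1: "poly p1 (of_real r * cis t) \<noteq> 0" and nz2: "poly p2 (of_real r * cis t) \<noteq> 0" for t
      using c1(2)[of "of_real r * cis t"] c2(2)[of "of_real r * cis t"] c1(1) c2(1) nr r' by auto
    have cH: "continuous_on A (\<lambda>t. H (of_real r * cis t))" for A
      by (intro continuous_on_compose2[OF holomorphic_on_imp_continuous_on[OF H]] continuous_intros) auto
    have Li: "L integrable_on {0..2*pi}"
      unfolding L_def gH log_plus_def
      by (intro integrable_continuous_interval continuous_intros cH) (auto simp: nz2)
    have "max 0 (Re (H (of_real r * cis t))) \<le> L t + (ln B + real d) * ln r" for t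
    proof -
      let ?z = "of_real r * cis t"
      have "norm (exp (H ?z)) = norm (g ?z) * (norm (poly p2 ?z) / norm (poly p1 ?z))"
        using nz1 nz2 by (simp add: gH norm_mult norm_divide)
      hence "max 0 (Re (H ?z)) = log_plus (norm (g ?z) * (norm (poly p2 ?z) / norm (poly p1 ?z)))"
        by (simp flip: log_plus_exp add: norm_exp_eq_Re)
      also have "\<dots> \<le> L t + log_plus (norm (poly p2 ?z) / norm (poly p1 ?z))"
        unfolding L_def by (rule log_plus_mult_le) auto
      also have "log_plus (norm (poly p2 ?z) / norm (poly p1 ?z)) \<le> log_plus (B * r ^ d)"
      proof (rule log_plus_mono)
        have "norm (poly p2 ?z) / norm (poly p1 ?z) \<le> (M * r ^ d) / c1"
          using M(2)[of ?z] c1 nr[of t] r' rp M(1) unfolding d_def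
          by (intro frac_le) auto
        also have "\<dots> \<le> B * r ^ d"
          using rp by (simp add: B_def mult_right_mono flip: times_divide_eq_left)
        finally show "norm (poly p2 ?z) / norm (poly p1 ?z) \<le> B * r ^ d" .
      qed
      also have "log_plus (B * r ^ d) = ln B + real d * ln r"
      proof -
        have "B \<ge> 1" by (simp add: B_def)
        moreover have "1 * 1 \<le> B * r ^ d" using rp by (intro mult_mono) (auto simp: B_def)
        ultimately show ?thesis using rp by (simp add: log_plus_def max_def ln_mult ln_realpow)
      qed
      also have "ln B \<le> ln B * ln r" using lr by (simp add: B_def mult_le_cancel_left1)
      finally show ?thesis by (simp add: algebra_simps)
    qed
    hence "integral {0..2*pi} (\<lambda>t. max 0 (Re (H (of_real r * cis t))))
       \<le> integral {0..2*pi} (\<lambda>t. L t + (ln B + real d) * ln r)"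
      by (intro integral_le integrable_add Li integrable_continuous_interval continuous_intros cH) auto
    also have "\<dots> = integral {0..2*pi} L + 2 * pi * (ln B + real d) * ln r"
      by (subst integral_add) (auto intro: Li)
    also have "integral {0..2*pi} L = 2 * pi * proximity g r"
      by (simp add: proximity_def L_def)
    also have "proximity g r = proximity w r"
      using proximity_cong[OF wg rp(1)] by simp
    also have "2 * pi * proximity w r \<le> 2 * pi * (C * ln r)" using pr by simp
    finally show ?thesis by (simp add: algebra_simps)
  qed
  have Hc: "H z = H 0" for z
  proof (rule entire_constant_of_ln_growth[OF H])
    fix R
    obtain r where "r \<ge> max R R0" "proximity w r \<le> C * ln r" using C by blast
    thus "\<exists>r\<ge>R. integral {0..2*pi} (\<lambda>t. max 0 (Re (H (of_real r * cis t))))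
        \<le> 2 * pi * (C + (ln B + real d)) * ln r" using main by auto
  qed
  have "g z = poly (smult (exp (H 0)) p1) z / poly p2 z" for z
    using gH[of z] by (simp add: Hc[of z])
  with wg have "\<forall>\<^sub>\<approx>z. w z = poly (smult (exp (H 0)) p1) z / poly p2 z"
    by simp
  with p2(1) show ?thesis
    unfolding rational_function_def by blast
qed

section \<open>Rational functions near infinity\<close>

text \<open>Bounded sets are ignored, so the class is closed under translation and under division by
  any member without zeros at large arguments.\<close>

definition rational_near_infinity :: "(complex \<Rightarrow> complex) \<Rightarrow> bool" where
  "rational_near_infinity f \<longleftrightarrow>
     (\<exists>p q. \<forall>\<^sub>F z in at_infinity. poly q z \<noteq> 0 \<and> f z = poly p z / poly q z)"

lemma eventually_poly_nonzero:
  fixes p :: "complex poly"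
  assumes "p \<noteq> 0"
  shows "\<forall>\<^sub>F z in at_infinity. poly p z \<noteq> 0"
proof -
  obtain R c where "c > 0" "\<And>z. norm z \<ge> R \<Longrightarrow> c \<le> norm (poly p z)"
    using poly_norm_lower_bound[OF assms] by blast
  thus ?thesis unfolding eventually_at_infinity by (metis norm_zero not_le)
qed

lemma rational_near_infinity_poly: "rational_near_infinity (poly p)"
  unfolding rational_near_infinity_def by (rule exI[of _ p], rule exI[of _ 1]) simp

lemma rational_near_infinity_const: "rational_near_infinity (\<lambda>_. c)"
proof -
  have "poly [:c:] = (\<lambda>_. c)" by auto
  thus ?thesis by (metis rational_near_infinity_poly)
qed

lemma rational_near_infinity_ident: "rational_near_infinity (\<lambda>z. z)"
proof -
  have "poly [:0, 1 :: complex:] = (\<lambda>z. z)" by auto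
  thus ?thesis by (metis rational_near_infinity_poly)
qed

lemma rational_near_infinity_add:
  assumes "rational_near_infinity f" "rational_near_infinity g"
  shows "rational_near_infinity (\<lambda>z. f z + g z)"
proof -
  obtain p q p' q' where f: "\<forall>\<^sub>F z in at_infinity. poly q z \<noteq> 0 \<and> f z = poly p z / poly q z"
    and g: "\<forall>\<^sub>F z in at_infinity. poly q' z \<noteq> 0 \<and> g z = poly p' z / poly q' z"
    using assms by (auto simp: rational_near_infinity_def)
  have "\<forall>\<^sub>F z in at_infinity. poly (q * q') z \<noteq> 0 \<and> f z + g z = poly (p * q' + p' * q) z / poly (q * q') z"
    using f g by eventually_elim (simp add: field_simps)
  thus ?thesis unfolding rational_near_infinity_def by blast
qed

lemma rational_near_infinity_mult:
  assumes "rational_near_infinity f" "rational_near_infinity g"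
  shows "rational_near_infinity (\<lambda>z. f z * g z)"
proof -
  obtain p q p' q' where f: "\<forall>\<^sub>F z in at_infinity. poly q z \<noteq> 0 \<and> f z = poly p z / poly q z"
    and g: "\<forall>\<^sub>F z in at_infinity. poly q' z \<noteq> 0 \<and> g z = poly p' z / poly q' z"
    using assms by (auto simp: rational_near_infinity_def)
  have "\<forall>\<^sub>F z in at_infinity. poly (q * q') z \<noteq> 0 \<and> f z * g z = poly (p * p') z / poly (q * q') z"
    using f g by eventually_elim simp
  thus ?thesis unfolding rational_near_infinity_def by blast
qed

lemma rational_near_infinity_diff:
  assumes "rational_near_infinity f" "rational_near_infinity g"
  shows "rational_near_infinity (\<lambda>z. f z - g z)"
  using rational_near_infinity_add[OF assms(1) rational_near_infinity_mult[OF rational_near_infinity_const[of "-1"] assms(2)]]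
  by simp

lemma rational_near_infinity_divide:
  assumes "rational_near_infinity f" "rational_near_infinity g"
    and nz: "\<forall>\<^sub>F z in at_infinity. g z \<noteq> 0"
  shows "rational_near_infinity (\<lambda>z. f z / g z)"
proof -
  obtain p q where f: "\<forall>\<^sub>F z in at_infinity. poly q z \<noteq> 0 \<and> g z = poly p z / poly q z"
    using assms by (auto simp: rational_near_infinity_def)
  have "\<forall>\<^sub>F z in at_infinity. poly p z \<noteq> 0 \<and> 1 / g z = poly q z / poly p z"
    using f nz by eventually_elim auto
  hence "rational_near_infinity (\<lambda>z. 1 / g z)" unfolding rational_near_infinity_def by blast
  from rational_near_infinity_mult[OF assms(1) this] show ?thesis by simp
qed

lemma eventually_at_infinity_translate:
  fixes c :: complex
  assumes "\<forall>\<^sub>F z in at_infinity. P z"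
  shows "\<forall>\<^sub>F z in at_infinity. P (z + c)"
proof -
  obtain R where R: "\<And>z. norm z \<ge> R \<Longrightarrow> P z"
    using assms by (auto simp: eventually_at_infinity)
  have "P (z + c)" if "norm z \<ge> R + norm c" for z
    using that norm_triangle_ineq4[of "z + c" c] by (intro R) simp
  thus ?thesis by (auto simp: eventually_at_infinity)
qed

lemma rational_near_infinity_translate:
  assumes "rational_near_infinity f"
  shows "rational_near_infinity (\<lambda>z. f (z + c))"
proof -
  obtain p q where "\<forall>\<^sub>F z in at_infinity. poly q z \<noteq> 0 \<and> f z = poly p z / poly q z"
    using assms by (auto simp: rational_near_infinity_def)
  from eventually_at_infinity_translate[OF this, of c]
  have "\<forall>\<^sub>F z in at_infinity. poly (q \<circ>\<^sub>p [:c, 1:]) z \<noteq> 0 \<and>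
      f (z + c) = poly (p \<circ>\<^sub>p [:c, 1:]) z / poly (q \<circ>\<^sub>p [:c, 1:]) z"
    by (simp add: poly_pcompose add.commute)
  thus ?thesis unfolding rational_near_infinity_def by blast
qed

text \<open>A nonzero numerator has only finitely many roots; this turns relations found at
  infinitely many poles into identities.\<close>

lemma rational_near_infinity_zero:
  assumes "rational_near_infinity f" "\<exists>\<^sub>F z in at_infinity. f z = 0"
  shows "\<forall>\<^sub>F z in at_infinity. f z = 0"
proof -
  obtain p q where f: "\<forall>\<^sub>F z in at_infinity. poly q z \<noteq> 0 \<and> f z = poly p z / poly q z"
    using assms by (auto simp: rational_near_infinity_def)
  show ?thesis
  proof (cases "p = 0")
    case True
    thus ?thesis using f by (auto elim: eventually_mono)
  next
    case False
    have "\<forall>\<^sub>F z in at_infinity. f z \<noteq> 0"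
      using f eventually_poly_nonzero[OF False] by eventually_elim auto
    thus ?thesis using assms(2) by (simp add: frequently_def)
  qed
qed

text \<open>Along the points \<open>(t + n) * c\<close> the value never changes, so \<open>f\<close>
  minus that value has zeros tending to infinity.\<close>

lemma rational_near_infinity_periodic:
  assumes f: "rational_near_infinity f" and per: "\<forall>\<^sub>F z in at_infinity. f (z + c) = f z" and c: "c \<noteq> 0"
  shows "\<exists>k. \<forall>\<^sub>F z in at_infinity. f z = k"
proof -
  obtain R where R: "\<And>z. norm z \<ge> R \<Longrightarrow> f (z + c) = f z"
    using per by (auto simp: eventually_at_infinity)
  \<comment> \<open>\<open>t * c\<close> has norm \<open>abs R\<close>, so the progression starts
    where periodicity is already valid.\<close>
  define t where "t = \<bar>R\<bar> / norm c"
  have tn: "norm (of_real (t + real n) * c) = \<bar>R\<bar> + real n * norm c" for n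
  proof -
    have "norm (of_real (t + real n) * c) = \<bar>t + real n\<bar> * norm c"
      by (simp only: norm_mult norm_of_real)
    also have "\<bar>t + real n\<bar> * norm c = \<bar>R\<bar> + real n * norm c"
      using c by (simp add: t_def distrib_right)
    finally show ?thesis .
  qed
  have val: "f (of_real (t + real n) * c) = f (of_real t * c)" for n
  proof (induction n)
    case (Suc n)
    have "R \<le> norm (of_real (t + real n) * c)" using tn[of n] by (simp add: add_increasing2)
    from R[OF this] Suc show ?case by (simp add: algebra_simps)
  qed simp
  have "\<exists>\<^sub>F z in at_infinity. f z - f (of_real t * c) = 0"
    unfolding frequently_def eventually_at_infinity
  proof
    assume "\<exists>b. \<forall>z. b \<le> norm z \<longrightarrow> f z - f (of_real t * c) \<noteq> 0"
    then obtain b where b: "\<And>z. b \<le> norm z \<Longrightarrow> f z \<noteq> f (of_real t * c)" by auto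
    obtain n where "b / norm c < real n" using reals_Archimedean2 by blast
    hence "b \<le> real n * norm c" using c by (simp add: field_simps)
    hence "b \<le> norm (of_real (t + real n) * c)" using tn[of n] by simp
    thus False using b val by blast
  qed
  with f have "\<forall>\<^sub>F z in at_infinity. f z - f (of_real t * c) = 0"
    by (intro rational_near_infinity_zero rational_near_infinity_diff rational_near_infinity_const)
  hence "\<forall>\<^sub>F z in at_infinity. f z = f (of_real t * c)" by simp
  thus ?thesis by blast
qed

text \<open>The first difference is 1-periodic, hence a constant \<mu>; then
  \<open>f z - \<mu> * z\<close> is 1-periodic and constant too.\<close>

lemma rational_near_infinity_second_difference:
  assumes f: "rational_near_infinity f"
    and eq: "\<exists>\<^sub>F z in at_infinity. f (z + 1) + f (z - 1) = 2 * f z"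
  shows "\<exists>l \<mu>. \<forall>\<^sub>F z in at_infinity. f z = l + \<mu> * z"
proof -
  have t: "rational_near_infinity (\<lambda>z. f (z + 1))"
    by (rule rational_near_infinity_translate[OF f])
  have s: "rational_near_infinity (\<lambda>z. f (z - 1))"
    using rational_near_infinity_translate[OF f, of "-1"] by simp
  have "\<forall>\<^sub>F z in at_infinity. f (z + 1) + f (z - 1) - 2 * f z = 0"
  proof (rule rational_near_infinity_zero)
    show "rational_near_infinity (\<lambda>z. f (z + 1) + f (z - 1) - 2 * f z)"
      by (intro rational_near_infinity_diff[OF rational_near_infinity_add[OF t s]]
          rational_near_infinity_mult[OF rational_near_infinity_const f])
  qed (use eq in simp)
  from eventually_at_infinity_translate[OF this, of 1]
  have "\<forall>\<^sub>F z in at_infinity. f (z + 1 + 1) - f (z + 1) = f (z + 1) - f z"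
    by eventually_elim (simp add: algebra_simps)
  hence "\<exists>k. \<forall>\<^sub>F z in at_infinity. f (z + 1) - f z = k"
    by (intro rational_near_infinity_periodic[of "\<lambda>z. f (z + 1) - f z" 1] rational_near_infinity_diff t f) auto
  then obtain \<mu> where mu: "\<forall>\<^sub>F z in at_infinity. f (z + 1) - f z = \<mu>" by blast
  have "\<forall>\<^sub>F z in at_infinity. f (z + 1) - \<mu> * (z + 1) = f z - \<mu> * z"
    using mu by eventually_elim (simp add: algebra_simps)
  hence "\<exists>k. \<forall>\<^sub>F z in at_infinity. f z - \<mu> * z = k"
    by (intro rational_near_infinity_periodic[of "\<lambda>z. f z - \<mu> * z" 1] rational_near_infinity_diff f
        rational_near_infinity_mult rational_near_infinity_const rational_near_infinity_ident) auto
  then obtain l where "\<forall>\<^sub>F z in at_infinity. f z - \<mu> * z = l" by blast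
  hence "\<forall>\<^sub>F z in at_infinity. f z = l + \<mu> * z" by eventually_elim (simp add: algebra_simps)
  thus ?thesis by blast
qed

text \<open>Carries identities back from large arguments to the plane: \<open>p - s * q\<close> has
  too many roots to be nonzero, and only the roots of \<open>q\<close> remain as possible
  exceptions.\<close>

lemma rational_eq_poly_cosparse:
  fixes p q s :: "complex poly"
  assumes q: "q \<noteq> 0" and ev: "\<forall>\<^sub>F z in at_infinity. poly p z / poly q z = poly s z"
  shows "\<forall>\<^sub>\<approx>z. poly p z / poly q z = poly s z"
proof -
  have p0: "\<forall>\<^sub>F z in at_infinity. poly (p - s * q) z = 0"
    using ev eventually_poly_nonzero[OF q] by eventually_elim (simp add: field_simps)
  have "p - s * q = 0"
  proof (rule ccontr)
    assume "p - s * q \<noteq> 0"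
    from eventually_poly_nonzero[OF this] p0 have "\<forall>\<^sub>F z::complex in at_infinity. False"
      by eventually_elim simp
    thus False unfolding eventually_at_infinity by (metis norm_of_real abs_ge_self)
  qed
  hence p: "p = s * q" by simp
  have "{z. poly q z = 0} sparse_in UNIV"
    using poly_roots_finite[OF q] by (rule finite_imp_sparse)
  hence "\<forall>\<^sub>\<approx>z. poly q z \<noteq> 0" by (simp add: eventually_cosparse)
  thus ?thesis by eventually_elim (simp add: p)
qed

lemma infinite_locally_finite_frequently_at_infinity:
  fixes G :: "complex set"
  assumes "infinite G" "\<And>r. finite (G \<inter> cball 0 r)"
  shows "\<exists>\<^sub>F z in at_infinity. z \<in> G"
  unfolding frequently_def eventually_at_infinity
proof
  assume "\<exists>b. \<forall>z. b \<le> norm z \<longrightarrow> z \<notin> G"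
  then obtain b where "\<And>z. b \<le> norm z \<Longrightarrow> z \<notin> G" by blast
  hence "G \<subseteq> G \<inter> cball 0 b" by force
  thus False using assms finite_subset by blast
qed

section \<open>Zeros and poles of a meromorphic function\<close>

text \<open>Read off the Laurent expansion, in which the equation is compared; \<open>nat\<close>
  makes it 0 at regular points and at zeros alike.\<close>

definition pole_order :: "(complex \<Rightarrow> complex) \<Rightarrow> complex \<Rightarrow> nat" where
  "pole_order w z = nat (- fls_subdegree (laurent_expansion w z))"

definition zero_set :: "(complex \<Rightarrow> complex) \<Rightarrow> complex set" where
  "zero_set w = {z. fls_subdegree (laurent_expansion w z) > 0}"

lemma finite_poles_cball:
  assumes "f meromorphic_on UNIV"
  shows "finite ({z. is_pole f z} \<inter> cball 0 r)"
proof -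
  have "{z. is_pole f z} sparse_in UNIV"
    using meromorphic_on_imp_not_pole_cosparse[OF assms] by (simp add: eventually_cosparse)
  hence "{z. is_pole f z} sparse_in cball 0 r" by (rule sparse_in_subset) auto
  from sparse_in_compact_finite[OF this] show ?thesis by (simp add: Int_commute)
qed

text \<open>Apart from 0 itself, the finitely many points of \<open>A\<close> in the unit disc keep
  a positive distance from 0, so nothing new is counted at small radii.\<close>

lemma counting_functionI:
  fixes A :: "complex set" and g :: "complex \<Rightarrow> nat"
  assumes fin: "\<And>r. finite (A \<inter> cball 0 r)"
  shows "counting_function (\<lambda>r. \<Sum>p\<in>A \<inter> cball 0 r. g p)"
proof -
  have "\<exists>d>0. \<forall>x\<in>A \<inter> cball 0 1. x \<noteq> 0 \<longrightarrow> d \<le> dist 0 x"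
    by (rule finite_set_avoid[OF fin])
  then obtain d where d: "d > 0" "\<And>x. x \<in> A \<Longrightarrow> norm x \<le> 1 \<Longrightarrow> x \<noteq> 0 \<Longrightarrow> d \<le> norm x" by auto
  have eq: "A \<inter> cball 0 t = A \<inter> cball 0 0" if "0 \<le> t" "t < min d 1" for t
    using that d by force
  have "(\<Sum>p\<in>A \<inter> cball 0 x. g p) \<le> (\<Sum>p\<in>A \<inter> cball 0 y. g p)" if "x \<le> y" for x y
    using that fin by (intro sum_mono2) auto
  moreover have "min d 1 > 0" using d by simp
  ultimately show ?thesis
    unfolding counting_function_def using eq by metis
qed

context
  fixes w :: "complex \<Rightarrow> complex"
  assumes w: "w meromorphic_on UNIV" and nz: "\<not> (\<forall>\<^sub>\<approx>z. w z = 0)"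
begin

lemma pole_order_pos_iff: "pole_order w z > 0 \<longleftrightarrow> is_pole w z"
  by (simp add: pole_order_def meromorphic_is_pole_iff[OF w])

lemma zero_set_eq: "zero_set w = {z. is_pole (\<lambda>z. 1 / w z) z}"
  by (simp add: zero_set_def meromorphic_is_pole_inverse_iff[OF w])

lemma finite_zero_set_cball: "finite (zero_set w \<inter> cball 0 r)"
  unfolding zero_set_eq by (intro finite_poles_cball meromorphic_intros w)

lemma finite_pole_order_cball: "finite ({z. pole_order w z > 0} \<inter> cball 0 r)"
  unfolding pole_order_pos_iff by (intro finite_poles_cball w)

lemma zorder_eq_subdegree: "zorder w z = fls_subdegree (laurent_expansion w z)"
  by (intro has_laurent_expansion_zorder meromorphic_laurent w meromorphic_laurent_nonzero nz)

lemma pole_count_eq: "pole_count w r = (\<Sum>p | pole_order w p > 0 \<and> norm p \<le> r. pole_order w p)"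
  unfolding pole_count_def pole_order_pos_iff
  by (intro sum.cong) (auto simp: zorder_eq_subdegree pole_order_def)

lemma distinct_pole_count_inverse_eq: "distinct_pole_count (\<lambda>z. 1 / w z) r = card (zero_set w \<inter> cball 0 r)"
  unfolding distinct_pole_count_def zero_set_eq by (intro arg_cong[of _ _ card]) auto

lemma counting_function_pole_count: "counting_function (pole_count w)"
proof -
  have "{p. pole_order w p > 0 \<and> norm p \<le> r} = {p. pole_order w p > 0} \<inter> cball 0 r" for r by auto
  hence "pole_count w = (\<lambda>r. \<Sum>p\<in>{p. pole_order w p > 0} \<inter> cball 0 r. pole_order w p)"
    by (simp add: fun_eq_iff pole_count_eq)
  thus ?thesis using counting_functionI[OF finite_pole_order_cball] by simp
qed

lemma counting_function_zeros: "counting_function (distinct_pole_count (\<lambda>z. 1 / w z))"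
proof -
  have "distinct_pole_count (\<lambda>z. 1 / w z) = (\<lambda>r. \<Sum>p\<in>zero_set w \<inter> cball 0 r. 1)"
    by (simp add: fun_eq_iff distinct_pole_count_inverse_eq)
  thus ?thesis using counting_functionI[OF finite_zero_set_cball, of "\<lambda>_. 1"] by simp
qed

lemma pole_count_unbounded:
  assumes "infinite {z. is_pole w z}"
  shows "\<exists>r\<ge>0. k \<le> pole_count w r"
proof -
  obtain B where B: "B \<subseteq> {z. is_pole w z}" "finite B" "card B = k"
    using infinite_arbitrarily_large[OF assms] by blast
  obtain r where r: "\<And>z. z \<in> B \<Longrightarrow> norm z \<le> r"
    using finite_imp_bounded[OF B(2)] by (auto simp: bounded_iff)
  have "k = (\<Sum>p\<in>B. 1)" using B by simp
  also have "\<dots> \<le> (\<Sum>p\<in>B. pole_order w p)"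
    using B(1) pole_order_pos_iff by (intro sum_mono) (auto simp: Suc_le_eq)
  also have "\<dots> \<le> pole_count w (max 0 r)"
    unfolding pole_count_eq
  proof (rule sum_mono2)
    have "{p. pole_order w p > 0 \<and> norm p \<le> max 0 r} = {p. pole_order w p > 0} \<inter> cball 0 (max 0 r)" by auto
    thus "finite {p. pole_order w p > 0 \<and> norm p \<le> max 0 r}" using finite_pole_order_cball by simp
    show "B \<subseteq> {p. pole_order w p > 0 \<and> norm p \<le> max 0 r}"
      using B r pole_order_pos_iff by (auto intro: le_max_iff_disj[THEN iffD2])
  qed auto
  finally show ?thesis by (intro exI[of _ "max 0 r"]) auto
qed

lemma nevanlinna_N_le_T: "integrated_count (pole_count w) r \<le> nevanlinna_T w r"
  using proximity_nonneg[of w r] by (simp add: nevanlinna_T_def nevanlinna_N_def)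

lemma infinite_poles_contradiction:
  assumes "infinite {z. is_pole w z}" and "hyper_order w < 1" and "\<epsilon> > 0" and "small_error w S"
    and "\<forall>\<^sub>F r in at_top. nevanlinna_Nbar (\<lambda>z. 1 / w z) r \<ge> (3 / 4 + \<epsilon>) * nevanlinna_T w r + S r"
    and K: "\<And>t. real (card (zero_set w \<inter> cball 0 t))
        \<le> 3 / 4 * real (\<Sum>p | pole_order w p > 0 \<and> norm p \<le> t + 1. pole_order w p) + K"
  shows False
proof -
  obtain E where E: "finite_log_measure E" "S \<in> o[inf at_top (principal (- E))](nevanlinna_T w)"
    using assms(4) by (auto simp: small_error_def)
  show False
  proof (rule integrated_count_contradiction[OF counting_function_pole_count counting_function_zeros])
    show "\<exists>r\<ge>0. k \<le> pole_count w r" for k by (rule pole_count_unbounded) fact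
    show "real (distinct_pole_count (\<lambda>z. 1 / w z) t) \<le> 3 / 4 * real (pole_count w (t + 1)) + K" for t
      using K by (simp add: pole_count_eq distinct_pole_count_inverse_eq)
  qed (use assms E nevanlinna_N_le_T in \<open>auto simp: hyper_order_def nevanlinna_Nbar_def\<close>)
qed

text \<open>Finitely many zeros bound \<open>Nbar\<close> of \<open>1 / w\<close> by
  \<open>D + k * ln r\<close>. Here \<epsilon> is spent entirely on absorbing \<open>S\<close>,
  which leaves \<open>3 / 4 * T \<le> D + k * ln r\<close> off \<open>E\<close>; the proximity
  function is below T.\<close>

lemma finite_poles_zeros_rational:
  assumes poles: "finite {z. is_pole w z}" and zeros: "finite (zero_set w)"
    and eps: "\<epsilon> > 0" and S: "small_error w S"
    and ge: "\<forall>\<^sub>F r in at_top. nevanlinna_Nbar (\<lambda>z. 1 / w z) r \<ge> (3 / 4 + \<epsilon>) * nevanlinna_T w r + S r"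
  shows "rational_function w"
proof -
  let ?T = "nevanlinna_T w"
  obtain E where E: "finite_log_measure E" "S \<in> o[inf at_top (principal (- E))](?T)"
    using S by (auto simp: small_error_def)
  define m where "m = distinct_pole_count (\<lambda>z. 1 / w z)"
  have m: "counting_function m" unfolding m_def by (rule counting_function_zeros)
  obtain D where D: "\<forall>r\<ge>1. integrated_count m r = D + integral {1..r} (\<lambda>t. real (m t) / t)"
    using integrated_count_eq[OF m] by blast
  define k where "k = real (card (zero_set w))"
  have mk: "real (m t) \<le> k" for t
    unfolding m_def k_def distinct_pole_count_inverse_eq using zeros by (simp add: card_mono)
  have mle: "integrated_count m r \<le> D + k * ln r" if r: "r \<ge> 1" for r
  proof -
    have "integral {1..r} (\<lambda>t. real (m t) / t) \<le> integral {1..r} (\<lambda>t. k / t)"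
      using has_integral_inverse_ln[of 1 r k] r mk counting_function_integrable[OF m, of 1 r]
      by (intro integral_le divide_right_mono) (auto simp: has_integral_integrable)
    also have "\<dots> = k * ln r" using has_integral_inverse_ln[of 1 r k] r by (simp add: integral_unique)
    finally show ?thesis using D r by auto
  qed
  have "\<forall>\<^sub>F r in inf at_top (principal (- E)). norm (S r) \<le> \<epsilon> * norm (?T r)"
    using landau_o.smallD[OF E(2) eps] .
  hence S': "\<forall>\<^sub>F r in at_top. r \<notin> E \<longrightarrow> \<bar>S r\<bar> \<le> \<epsilon> * \<bar>?T r\<bar>"
    by (simp add: eventually_inf_principal)
  have "\<forall>\<^sub>F r::real in at_top. r \<ge> exp 1" by (rule eventually_ge_at_top)
  hence "\<forall>\<^sub>F r in at_top. r \<notin> E \<longrightarrow> proximity w r \<le> 4 / 3 * (\<bar>D\<bar> + k) * ln r"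
    using S' ge
  proof eventually_elim
    case (elim r)
    show ?case
    proof
      assume rE: "r \<notin> E"
      have r1: "r \<ge> 1" using elim(1) exp_ge_add_one_self[of 1] by linarith
      have lr: "ln r \<ge> 1" using elim(1) r1 by (subst ln_ge_iff) auto
      have N0: "0 \<le> integrated_count (pole_count w) r"
        by (rule integrated_count_nonneg[OF counting_function_pole_count r1])
      hence T: "proximity w r \<le> ?T r" "0 \<le> ?T r"
        using proximity_nonneg[of w r] by (simp_all add: nevanlinna_T_def nevanlinna_N_def)
      have "(3 / 4 + \<epsilon>) * ?T r + S r \<le> D + k * ln r"
        using elim(3) mle[OF r1] by (simp add: nevanlinna_Nbar_def m_def)
      moreover have "\<bar>S r\<bar> \<le> \<epsilon> * ?T r" using elim(2) rE T by simp
      ultimately have "3 / 4 * ?T r \<le> D + k * ln r" by (simp add: distrib_right)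
      also have "D \<le> \<bar>D\<bar> * ln r"
        using lr mult_left_mono[of 1 "ln r" "\<bar>D\<bar>"] by simp
      finally show "proximity w r \<le> 4 / 3 * (\<bar>D\<bar> + k) * ln r"
        using T by (simp add: algebra_simps)
    qed
  qed
  then obtain R where R: "\<And>r. r \<ge> R \<Longrightarrow> r \<notin> E \<Longrightarrow> proximity w r \<le> 4 / 3 * (\<bar>D\<bar> + k) * ln r"
    by (auto simp: eventually_at_top_linorder)
  show ?thesis
  proof (rule rational_of_proximity_ln_growth[OF w nz poles])
    show "finite {z. is_pole (\<lambda>z. 1 / w z) z}" using zeros by (simp add: zero_set_eq)
    fix R'
    obtain r where "r \<ge> max R R'" "r \<notin> E" using finite_log_measure_unbounded_complement[OF E(1)] by blast
    thus "\<exists>r\<ge>R'. proximity w r \<le> 4 / 3 * (\<bar>D\<bar> + k) * ln r" using R by auto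
  qed
qed

end

section \<open>The delay differential equation\<close>

text \<open>An identity off a sparse set holds in a punctured neighbourhood of \<open>x\<close>;
  with all translates expanded in the same variable, uniqueness of Laurent series makes it a formal
  identity.\<close>

lemma laurent_expansion_delay_equation:
  assumes w: "w meromorphic_on UNIV" and nz: "\<not> (\<forall>\<^sub>\<approx>z. w z = 0)"
    and eq: "\<forall>\<^sub>\<approx>z. w (z + 1) - w (z - 1) = (A z * deriv w z + B z * w z) / (w z)^2 + c z"
    and an: "A analytic_on {x}" "B analytic_on {x}" "c analytic_on {x}"
  shows "laurent_expansion w (x + 1) - laurent_expansion w (x - 1)
     = delay_term (fps_expansion A x) (fps_expansion B x) (laurent_expansion w x) + fps_to_fls (fps_expansion c x)"
proof -
  let ?L = "laurent_expansion w"
  have L: "(\<lambda>u. w (z + u)) has_laurent_expansion ?L z" for z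
    by (rule meromorphic_laurent[OF w])
  have dL: "(\<lambda>u. deriv w (x + u)) has_laurent_expansion fls_deriv (?L x)"
  proof -
    have "deriv (\<lambda>u. w (x + u)) = (\<lambda>u. deriv w (x + u))"
    proof
      fix u show "deriv (\<lambda>u. w (x + u)) u = deriv w (x + u)"
        by (subst (1 2) deriv_shift_0) (simp add: o_def add.assoc)
    qed
    thus ?thesis using has_laurent_expansion_deriv[OF L[of x]] by simp
  qed
  have an': "(\<lambda>u. f (x + u)) has_laurent_expansion fps_to_fls (fps_expansion f x)" if "f analytic_on {x}" for f
    using that by (intro has_laurent_expansion_fps analytic_at_imp_has_fps_expansion)
  have 1: "(\<lambda>u. w ((x + 1) + u) - w ((x - 1) + u)) has_laurent_expansion ?L (x + 1) - ?L (x - 1)"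
    by (intro laurent_expansion_intros L)
  have 2: "(\<lambda>u. (A (x + u) * deriv w (x + u) + B (x + u) * w (x + u)) / (w (x + u))^2 + c (x + u))
     has_laurent_expansion delay_term (fps_expansion A x) (fps_expansion B x) (?L x) + fps_to_fls (fps_expansion c x)"
    unfolding delay_term_def by (intro laurent_expansion_intros L dL an' an)
  have 3: "\<forall>\<^sub>F u in at 0. w ((x + 1) + u) - w ((x - 1) + u)
      = (A (x + u) * deriv w (x + u) + B (x + u) * w (x + u)) / (w (x + u))^2 + c (x + u)"
  proof -
    have "\<forall>\<^sub>F z in at x. w (z + 1) - w (z - 1) = (A z * deriv w z + B z * w z) / (w z)^2 + c z"
      using eq by (simp add: eventually_cosparse_open_eq)
    hence "\<forall>\<^sub>F u in at 0. w ((x + u) + 1) - w ((x + u) - 1)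
       = (A (x + u) * deriv w (x + u) + B (x + u) * w (x + u)) / (w (x + u))^2 + c (x + u)"
      by (simp add: at_to_0' eventually_filtermap add.commute)
    thus ?thesis by eventually_elim (simp add: algebra_simps)
  qed
  show ?thesis
    using has_laurent_expansion_unique[OF 1[unfolded has_laurent_expansion_cong[OF 3 refl]] 2] .
qed

lemma poly_ratio_analytic:
  fixes p q :: "complex poly"
  assumes "poly q x \<noteq> 0"
  shows "(\<lambda>z. poly p z / poly q z) analytic_on {x}"
proof (rule analytic_on_divide)
  have "poly r holomorphic_on UNIV" for r :: "complex poly"
    by (auto simp: holomorphic_on_def field_differentiable_def intro: poly_DERIV)
  thus "poly p analytic_on {x}" "poly q analytic_on {x}"
    using analytic_on_holomorphic by blast+
qed (use assms in auto)

context
  fixes w :: "complex \<Rightarrow> complex" and A B c :: "complex \<Rightarrow> complex" and R :: real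
  assumes w: "w meromorphic_on UNIV" and nz: "\<not> (\<forall>\<^sub>\<approx>z. w z = 0)"
    and eq: "\<forall>\<^sub>\<approx>z. w (z + 1) - w (z - 1) = (A z * deriv w z + B z * w z) / (w z)^2 + c z"
    and R: "\<forall>x. R \<le> norm x \<longrightarrow> A analytic_on {x} \<and> B analytic_on {x} \<and> c analytic_on {x} \<and> A x \<noteq> 0"
begin

lemma fps_expansion_A_nonzero: "R \<le> norm x \<Longrightarrow> fps_nth (fps_expansion A x) 0 \<noteq> 0"
  using R by (simp add: fps_expansion_def)

lemma local_equation:
  assumes "R \<le> norm x"
  shows "laurent_expansion w (x + 1) - laurent_expansion w (x - 1)
     = delay_term (fps_expansion A x) (fps_expansion B x) (laurent_expansion w x) + fps_to_fls (fps_expansion c x)"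
  using R assms by (intro laurent_expansion_delay_equation w nz eq) auto

lemma laurent_w_nonzero: "laurent_expansion w x \<noteq> 0"
  by (rule meromorphic_laurent_nonzero[OF w nz])

text \<open>At a zero of order n the delay term has order - n - 1, at most -2; as \<open>c\<close>
  is analytic, this pole has to come from one of the two translates.\<close>

lemma zero_neighbour_pole_order:
  assumes "x \<in> zero_set w" and "R \<le> norm x"
  shows "pole_order w (x - 1) \<ge> 2 \<or> pole_order w (x + 1) \<ge> 2"
proof (rule ccontr)
  assume neg: "\<not> ?thesis"
  let ?L = "laurent_expansion w"
  let ?d = "delay_term (fps_expansion A x) (fps_expansion B x) (?L x)"
  let ?C = "fps_to_fls (fps_expansion c x)"
  have s: "fls_subdegree (?L x) > 0" using assms by (simp add: zero_set_def)
  have d: "?d \<noteq> 0" "fls_subdegree ?d = - fls_subdegree (?L x) - 1"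
    using delay_term_subdegree[OF laurent_w_nonzero _ fps_expansion_A_nonzero[OF assms(2)]] s by auto
  have ge: "fls_subdegree (?L (x + 1)) \<ge> -1" "fls_subdegree (?L (x - 1)) \<ge> -1"
    using neg by (auto simp: pole_order_def)
  have "?d = (?L (x + 1) - ?L (x - 1)) - ?C"
    using local_equation[OF assms(2)] by simp
  moreover have "fls_nth ((?L (x + 1) - ?L (x - 1)) - ?C) (fls_subdegree ?d) = 0"
    using ge s d(2) by simp
  ultimately have "fls_nth ?d (fls_subdegree ?d) = 0" by simp
  thus False using d(1) by simp
qed

text \<open>Between two zeros the left side has vanishing constant coefficient. At a pole of order m
  the delay term has order m - 1, so its constant coefficient is nonzero for m = 1 and zero for m at
  least 2; either way the value of \<open>c\<close> does not fit.\<close>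

lemma pole_neighbours_not_both_zeros:
  assumes x: "R \<le> norm x"
    and "pole_order w x = 1 \<and> c x = 0 \<or> pole_order w x \<ge> 2 \<and> c x \<noteq> 0"
  shows "x - 1 \<notin> zero_set w \<or> x + 1 \<notin> zero_set w"
proof (rule ccontr)
  assume neg: "\<not> ?thesis"
  let ?L = "laurent_expansion w"
  let ?d = "delay_term (fps_expansion A x) (fps_expansion B x) (?L x)"
  let ?C = "fps_to_fls (fps_expansion c x)"
  have p: "fls_subdegree (?L x) = - int (pole_order w x)"
    using assms(2) by (auto simp: pole_order_def)
  have d: "?d \<noteq> 0" "fls_subdegree ?d = int (pole_order w x) - 1"
    using delay_term_subdegree[OF laurent_w_nonzero[of x] _ fps_expansion_A_nonzero[OF x]] p assms(2) by auto
  have "fls_nth (?L (x + 1) - ?L (x - 1)) 0 = 0"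
    using neg by (simp add: zero_set_def)
  hence "fls_nth ?d 0 + c x = 0"
    using local_equation[OF x] by (simp add: fps_expansion_def)
  moreover have "fls_nth ?d 0 \<noteq> 0" if "pole_order w x = 1"
    using d that by (metis diff_self nth_fls_subdegree_nonzero of_nat_1)
  moreover have "fls_nth ?d 0 = 0" if "pole_order w x \<ge> 2"
    using d that by simp
  ultimately show False using assms(2) by auto
qed

lemma double_pole_between_zeros_coefficients:
  assumes c0: "\<And>x. c x = 0" and x: "R + 1 \<le> norm x"
    and p: "pole_order w x = 2" "x - 1 \<in> zero_set w" "x + 1 \<in> zero_set w"
      "pole_order w (x - 2) = 0" "pole_order w (x + 2) = 0"
  shows "A (x + 1) + A (x - 1) = 2 * A x"
    and "(deriv A (x - 1) + B (x - 1)) * A (x + 1) = (deriv A (x + 1) + B (x + 1)) * A (x - 1)"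
proof -
  let ?L = "laurent_expansion w"
  \<comment> \<open>The margin 1 in \<open>R + 1\<close> keeps \<open>x - 1\<close> and
    \<open>x + 1\<close> in the region where the local equation is available.\<close>
  have R1: "R \<le> norm x" "R \<le> norm (x - 1)" "R \<le> norm (x + 1)"
    using x norm_triangle_ineq2[of x 1] norm_triangle_ineq2[of x "-1"] by auto
  have "c = (\<lambda>_. 0)" using c0 by auto
  hence Z: "fps_expansion c y = 0" for y
    by (simp add: fps_expansion_def fps_eq_iff)
  have eqs: "delay_term (fps_expansion A (x - 1)) (fps_expansion B (x - 1)) (?L (x - 1)) = ?L x - ?L (x - 2)"
      "delay_term (fps_expansion A x) (fps_expansion B x) (?L x) = ?L (x + 1) - ?L (x - 1)"
      "delay_term (fps_expansion A (x + 1)) (fps_expansion B (x + 1)) (?L (x + 1)) = ?L (x + 2) - ?L x"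
    using local_equation[OF R1(1)] local_equation[OF R1(2)] local_equation[OF R1(3)]
    by (simp_all add: Z add.commute)
  note * = double_pole_between_zeros[OF eqs laurent_w_nonzero _ laurent_w_nonzero]
  have pre: "fls_subdegree (?L (x - 1)) > 0" "fls_subdegree (?L (x + 1)) > 0" "fls_subdegree (?L x) = -2"
    "fls_subdegree (?L (x - 2)) \<ge> 0" "fls_subdegree (?L (x + 2)) \<ge> 0"
    using p by (auto simp: zero_set_def pole_order_def)
  show "A (x + 1) + A (x - 1) = 2 * A x"
    using *(1) pre fps_expansion_A_nonzero R1 by (auto simp: fps_expansion_def)
  show "(deriv A (x - 1) + B (x - 1)) * A (x + 1) = (deriv A (x + 1) + B (x + 1)) * A (x - 1)"
    using *(2) pre fps_expansion_A_nonzero R1 by (auto simp: fps_expansion_def)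
qed

end


text \<open>Condition \<open>1\<close> makes \<open>A\<close> affine with slope \<mu>. Condition
  \<open>2\<close> then says that \<open>(\<mu> + B) / A\<close> agrees at \<open>z + 1\<close> and
  \<open>z - 1\<close>; being rational and 2-periodic it is a constant \<nu>, and
  \<open>B = \<nu> * A - \<mu>\<close> is the asserted form.\<close>

lemma delay_equation_coefficients:
  fixes A B :: "complex \<Rightarrow> complex"
  assumes A: "rational_near_infinity A" and B: "rational_near_infinity B"
    and A0: "\<forall>\<^sub>F z in at_infinity. A z \<noteq> 0"
    and 1: "\<exists>\<^sub>F z in at_infinity. A (z + 1) + A (z - 1) = 2 * A z"
    and 2: "\<exists>\<^sub>F z in at_infinity. (deriv A (z - 1) + B (z - 1)) * A (z + 1) = (deriv A (z + 1) + B (z + 1)) * A (z - 1)"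
  shows "\<exists>l \<mu> \<nu>. (\<forall>\<^sub>F z in at_infinity. A z = l + \<mu> * z) \<and>
      (\<forall>\<^sub>F z in at_infinity. B z = \<nu> * l + \<mu> * (\<nu> * z - 1))"
proof -
  obtain l \<mu> where lin: "\<forall>\<^sub>F z in at_infinity. A z = l + \<mu> * z"
    using rational_near_infinity_second_difference[OF A 1] by blast
  then obtain R where R: "\<And>z. norm z \<ge> R \<Longrightarrow> A z = l + \<mu> * z"
    by (auto simp: eventually_at_infinity)
  \<comment> \<open>Differentiation needs the affine formula on a neighbourhood; the unit disc about
    \<open>z\<close> stays outside radius \<open>R\<close>.\<close>
  have dA: "deriv A z = \<mu>" if "norm z \<ge> R + 1" for z
  proof -
    have "\<forall>\<^sub>F u in nhds z. A u = l + \<mu> * u"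
      unfolding eventually_nhds_metric
    proof (intro exI[of _ 1] conjI allI impI)
      fix u assume "dist u z < 1"
      hence "norm u \<ge> R" using that norm_triangle_ineq2[of z "z - u"] by (simp add: dist_norm norm_minus_commute)
      thus "A u = l + \<mu> * u" by (rule R)
    qed simp
    hence "deriv A z = deriv (\<lambda>u. l + \<mu> * u) z" by (intro deriv_cong_ev) auto
    also have "\<dots> = \<mu>" by (intro DERIV_imp_deriv) (auto intro!: derivative_eq_intros)
    finally show ?thesis .
  qed
  hence dA': "\<forall>\<^sub>F z in at_infinity. deriv A z = \<mu>" by (auto simp: eventually_at_infinity)
  define f where "f = (\<lambda>z. (\<mu> + B z) / A z)"
  have f: "rational_near_infinity f"
    unfolding f_def by (intro rational_near_infinity_divide rational_near_infinity_add
        rational_near_infinity_const A B A0)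
  have fp: "rational_near_infinity (\<lambda>z. f (z + 1))" by (rule rational_near_infinity_translate[OF f])
  have fm: "rational_near_infinity (\<lambda>z. f (z - 1))"
    using rational_near_infinity_translate[OF f, of "-1"] by simp
  have sh: "\<forall>\<^sub>F z in at_infinity. A (z + 1) \<noteq> 0 \<and> A (z - 1) \<noteq> 0 \<and> deriv A (z + 1) = \<mu> \<and> deriv A (z - 1) = \<mu>"
    using eventually_at_infinity_translate[OF A0, of 1] eventually_at_infinity_translate[OF A0, of "-1"]
      eventually_at_infinity_translate[OF dA', of 1] eventually_at_infinity_translate[OF dA', of "-1"]
    by eventually_elim simp
  have "\<exists>\<^sub>F z in at_infinity. f (z + 1) - f (z - 1) = 0"
    using frequently_eventually_frequently[OF 2 sh]
    by (rule frequently_elim1) (auto simp: f_def field_simps)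
  with fp fm have "\<forall>\<^sub>F z in at_infinity. f (z + 1) - f (z - 1) = 0"
    by (intro rational_near_infinity_zero rational_near_infinity_diff)
  from eventually_at_infinity_translate[OF this, of 1]
  have "\<forall>\<^sub>F z in at_infinity. f (z + 2) = f z"
    by eventually_elim (simp add: add.assoc)
  then obtain \<nu> where nu: "\<forall>\<^sub>F z in at_infinity. f z = \<nu>"
    using rational_near_infinity_periodic[OF f, of 2] by auto
  have "\<forall>\<^sub>F z in at_infinity. B z = \<nu> * l + \<mu> * (\<nu> * z - 1)"
    using nu lin A0
  proof eventually_elim
    case (elim z)
    have "\<mu> + B z = \<nu> * A z" using elim(1,3) by (simp add: f_def field_simps)
    thus ?case using elim(2) by (simp add: algebra_simps eq_diff_eq)
  qed
  with lin show ?thesis by blast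
qed

theorem theorem1p3:
  fixes a b c w :: "complex \<Rightarrow> complex" and \<epsilon> :: real and S :: "real \<Rightarrow> real"
  assumes "rational_function a" and "rational_function b" and "rational_function c"
    and "\<not> (\<forall>\<^sub>\<approx>z. a z = 0)"
    and "w meromorphic_on UNIV" and "\<not> rational_function w"
    and "\<forall>\<^sub>\<approx>z. w (z + 1) - w (z - 1) = (a z * deriv w z + b z * w z) / (w z)^2 + c z"
    and "hyper_order w < 1"
    and "\<epsilon> > 0"
    and "small_error w S"
    and "\<forall>\<^sub>F r in at_top.
           nevanlinna_Nbar (\<lambda>z. 1 / w z) r \<ge> (3 / 4 + \<epsilon>) * nevanlinna_T w r + S r"
  shows "\<exists>l \<mu> \<nu> :: complex.
           (\<forall>\<^sub>\<approx>z. a z = l + \<mu> * z) \<and>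
           (\<forall>\<^sub>\<approx>z. b z = \<nu> * l + \<mu> * (\<nu> * z - 1)) \<and>
           (\<forall>\<^sub>\<approx>z. c z = 0)"
proof -
  obtain pa qa where a: "qa \<noteq> 0" "\<forall>\<^sub>\<approx>z. a z = poly pa z / poly qa z"
    using assms(1) by (auto simp: rational_function_def)
  obtain pb qb where b: "qb \<noteq> 0" "\<forall>\<^sub>\<approx>z. b z = poly pb z / poly qb z"
    using assms(2) by (auto simp: rational_function_def)
  obtain pc qc where c: "qc \<noteq> 0" "\<forall>\<^sub>\<approx>z. c z = poly pc z / poly qc z"
    using assms(3) by (auto simp: rational_function_def)
  \<comment> \<open>Fixed rational representatives: \<open>a\<close>, \<open>b\<close>,
    \<open>c\<close> are determined only off sparse sets, whereas the local analysis uses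
    analyticity and values at every distant point.\<close>
  define A where "A = (\<lambda>z. poly pa z / poly qa z)"
  define B where "B = (\<lambda>z. poly pb z / poly qb z)"
  define C where "C = (\<lambda>z. poly pc z / poly qc z)"
  note w = assms(5)
  have nz: "\<not> (\<forall>\<^sub>\<approx>z. w z = 0)"
  proof
    assume "\<forall>\<^sub>\<approx>z. w z = 0"
    hence "\<forall>\<^sub>\<approx>z. w z = poly 0 z / poly 1 z" by simp
    hence "rational_function w" unfolding rational_function_def using one_neq_zero by blast
    thus False using assms(6) by blast
  qed
  have pa: "pa \<noteq> 0"
    using a(2) assms(4) by auto
  have eq: "\<forall>\<^sub>\<approx>z. w (z + 1) - w (z - 1) = (A z * deriv w z + B z * w z) / (w z)^2 + C z"
    using assms(7) a(2) b(2) c(2) by eventually_elim (simp add: A_def B_def C_def)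
  have A0: "\<forall>\<^sub>F z in at_infinity. A z \<noteq> 0"
    using eventually_poly_nonzero[OF pa] eventually_poly_nonzero[OF a(1)]
    by eventually_elim (simp add: A_def)
  have "\<forall>\<^sub>F z in at_infinity. (A analytic_on {z} \<and> B analytic_on {z} \<and> C analytic_on {z} \<and> A z \<noteq> 0) \<and>
      (pc \<noteq> 0 \<longrightarrow> C z \<noteq> 0)"
  proof -
    have "\<forall>\<^sub>F z in at_infinity. pc \<noteq> 0 \<longrightarrow> poly pc z \<noteq> 0"
      by (cases "pc = 0") (use eventually_poly_nonzero[of pc] in auto)
    thus ?thesis
      using A0 eventually_poly_nonzero[OF a(1)] eventually_poly_nonzero[OF b(1)] eventually_poly_nonzero[OF c(1)]
      by eventually_elim (auto simp: A_def B_def C_def poly_ratio_analytic)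
  qed
  then obtain R where R: "\<forall>z. R \<le> norm z \<longrightarrow> A analytic_on {z} \<and> B analytic_on {z} \<and> C analytic_on {z} \<and> A z \<noteq> 0"
    and RC: "\<And>z. R \<le> norm z \<Longrightarrow> pc \<noteq> 0 \<Longrightarrow> C z \<noteq> 0"
    unfolding eventually_at_infinity by blast
  note nb = zero_neighbour_pole_order[OF w nz eq R]
  note sep = pole_neighbours_not_both_zeros[OF w nz eq R]
  note finZ = finite_zero_set_cball[OF w nz]
  note finP = finite_pole_order_cball[OF w nz]

  \<comment> \<open>Every distant zero is adjacent to a pole, so finitely many poles would leave
    finitely many zeros, and \<open>w\<close> would be rational.\<close>
  have inf: "infinite {z. is_pole w z}"
  proof
    assume fin: "finite {z. is_pole w z}"
    have "zero_set w \<subseteq> (zero_set w \<inter> cball 0 R) \<union> (\<lambda>z. z + 1) ` {z. is_pole w z} \<union> (\<lambda>z. z - 1) ` {z. is_pole w z}"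
    proof
      fix z assume z: "z \<in> zero_set w"
      show "z \<in> (zero_set w \<inter> cball 0 R) \<union> (\<lambda>z. z + 1) ` {z. is_pole w z} \<union> (\<lambda>z. z - 1) ` {z. is_pole w z}"
      proof (cases "norm z \<le> R")
        case False
        hence "is_pole w (z - 1) \<or> is_pole w (z + 1)"
          using nb[OF z] pole_order_pos_iff[OF w nz, of "z - 1"] pole_order_pos_iff[OF w nz, of "z + 1"] by auto
        moreover have "z = (z - 1) + 1" "z = (z + 1) - 1" by simp_all
        ultimately show ?thesis by blast
      qed (use z in auto)
    qed
    hence "finite (zero_set w)" by (rule finite_subset) (use fin finZ in auto)
    hence "rational_function w"
      using finite_poles_zeros_rational[OF w nz fin _ assms(9,10,11)] by blast
    thus False using assms(6) by blast
  qed
  note contra = infinite_poles_contradiction[OF w nz inf assms(8,9,10,11)]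

  \<comment> \<open>If the numerator of \<open>C\<close> were nonzero, \<open>C\<close> would have
    no zeros beyond \<open>R\<close>, so no multiple pole there could lie between two zeros.\<close>
  have pc0: "pc = 0"
  proof (rule ccontr)
    assume pc: "pc \<noteq> 0"
    have "\<exists>K. \<forall>t. real (card (zero_set w \<inter> cball 0 t))
       \<le> 3 / 4 * real (\<Sum>p | pole_order w p > 0 \<and> norm p \<le> t + 1. pole_order w p) + K"
      by (rule card_le_half_sum_multiplicity[OF finZ finP, where R = R])
         (use nb sep RC[OF _ pc] in blast)+
    thus False using contra by blast
  qed
  have C0: "C z = 0" for z by (simp add: C_def pc0)
  define G where "G = {p. pole_order w p = 2 \<and> p - 1 \<in> zero_set w \<and> p + 1 \<in> zero_set w \<and>
      pole_order w (p - 2) = 0 \<and> pole_order w (p + 2) = 0}"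
  \<comment> \<open>Finitely many exceptional configurations would vanish in the constant of the
    charging bound.\<close>
  have infG: "infinite G"
  proof
    assume "finite G"
    hence "\<exists>K. \<forall>t. real (card (zero_set w \<inter> cball 0 t))
       \<le> 3 / 4 * real (\<Sum>p | pole_order w p > 0 \<and> norm p \<le> t + 1. pole_order w p) + K"
      unfolding G_def
      by (intro card_le_three_quarters_sum_multiplicity[OF finZ finP, where R = R])
         (use nb sep C0 in blast)+
    thus False using contra by blast
  qed
  have "G \<inter> cball 0 r \<subseteq> {p. pole_order w p > 0} \<inter> cball 0 r" for r by (auto simp: G_def)
  hence "finite (G \<inter> cball 0 r)" for r using finP finite_subset by blast
  hence "\<exists>\<^sub>F z in at_infinity. z \<in> G"
    by (intro infinite_locally_finite_frequently_at_infinity infG)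
  moreover have "\<forall>\<^sub>F z :: complex in at_infinity. R + 1 \<le> norm z"
    by (auto simp: eventually_at_infinity)
  ultimately have fr: "\<exists>\<^sub>F z in at_infinity. z \<in> G \<and> R + 1 \<le> norm z"
    using frequently_eventually_frequently by blast
  note co = double_pole_between_zeros_coefficients[OF w nz eq R C0]
  have rat: "rational_near_infinity A" "rational_near_infinity B"
    unfolding A_def B_def
    by (intro rational_near_infinity_divide rational_near_infinity_poly eventually_poly_nonzero a b)+
  obtain l \<mu> \<nu> where lin: "\<forall>\<^sub>F z in at_infinity. A z = l + \<mu> * z"
      "\<forall>\<^sub>F z in at_infinity. B z = \<nu> * l + \<mu> * (\<nu> * z - 1)"
  proof -
    have "\<exists>\<^sub>F z in at_infinity. A (z + 1) + A (z - 1) = 2 * A z"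
      using fr by (rule frequently_elim1) (use co(1) in \<open>auto simp: G_def\<close>)
    moreover have "\<exists>\<^sub>F z in at_infinity. (deriv A (z - 1) + B (z - 1)) * A (z + 1) = (deriv A (z + 1) + B (z + 1)) * A (z - 1)"
      using fr by (rule frequently_elim1) (use co(2) in \<open>auto simp: G_def\<close>)
    ultimately show ?thesis using delay_equation_coefficients[OF rat A0] that by blast
  qed
  have "\<forall>\<^sub>F z in at_infinity. poly pa z / poly qa z = poly [:l, \<mu>:] z"
    using lin(1) by eventually_elim (simp add: A_def mult.commute)
  from rational_eq_poly_cosparse[OF a(1) this] have 1: "\<forall>\<^sub>\<approx>z. a z = l + \<mu> * z"
    using a(2) by eventually_elim (simp add: mult.commute)
  have "\<forall>\<^sub>F z in at_infinity. poly pb z / poly qb z = poly [:\<nu> * l - \<mu>, \<mu> * \<nu>:] z"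
    using lin(2) by eventually_elim (simp add: B_def algebra_simps)
  from rational_eq_poly_cosparse[OF b(1) this] have 2: "\<forall>\<^sub>\<approx>z. b z = \<nu> * l + \<mu> * (\<nu> * z - 1)"
    using b(2) by eventually_elim (simp add: algebra_simps)
  have 3: "\<forall>\<^sub>\<approx>z. c z = 0"
    using c(2) by (simp add: pc0)
  from 1 2 3 show ?thesis by blast
qed

end
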